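(* Let either $(g_1,g_2)\in\mathcal{S}'(\mathbb{R}^d)\times\mathcal{S}(\mathbb{R}^d)$ or $(g_1,g_2)\in\mathcal{S}(\mathbb{R}^d)\times\mathcal{S}'(\mathbb{R}^d)$. Then the equality $$\hat m\,\mathcal{C}_{g_1,g_2}=\hat m\quad\text{in }\mathcal{S}'(\mathbb{R}^d)$$ holds for every $m\in\mathcal{S}(\mathbb{R}^d)$ if and only if $$\mathcal{C}_{g_1,g_2}=1\quad\text{in }\mathcal{S}'(\mathbb{R}^d).$$
   Context: $\hat m=\mathcal{F}m$ with $\mathcal{F}m(\omega)=\int_{\mathbb{R}^d}e^{-2\pi i t\cdot\omega}m(t)\,dt$. The window correlation function is $\mathcal{C}_{g_1,g_2}=(\mathcal{I}g_2)\ast\overline{g_1}$, where $\mathcal{I}g(t)=g(-t)$ (reflection and convolution in the sense of tempered distributions). *)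

theory Defs
  imports "HOL-Analysis.Analysis"
begin

section \<open>Schwartz functions\<close>

definition partial_derivative :: "'d::finite \<Rightarrow> (real^'d \<Rightarrow> complex) \<Rightarrow> real^'d \<Rightarrow> complex" where
  "partial_derivative i f x = vector_derivative (\<lambda>t. f (x + t *\<^sub>R axis i 1)) (at 0)"

text \<open>
  A list of coordinates plays the role of the multi-index of a derivative. For smooth
  functions the order of the coordinates is irrelevant.
\<close>

primrec iterated_partial :: "'d::finite list \<Rightarrow> (real^'d \<Rightarrow> complex) \<Rightarrow> real^'d \<Rightarrow> complex" where
  "iterated_partial [] f = f"
| "iterated_partial (i # is) f = partial_derivative i (iterated_partial is f)"

text \<open>
  Total differentiability of every iterated partial derivative makes all of them exist
  in the proper sense and be continuous, so this is membership in \<open>C\<^sup>\<infinity>\<close>.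
\<close>

definition smooth :: "(real^'d::finite \<Rightarrow> complex) \<Rightarrow> bool" where
  "smooth f \<longleftrightarrow> (\<forall>is x. iterated_partial is f differentiable at x)"

definition monomial :: "('d::finite \<Rightarrow> nat) \<Rightarrow> real^'d \<Rightarrow> real" where
  "monomial \<alpha> x = (\<Prod>i\<in>UNIV. (x $ i) ^ \<alpha> i)"

definition schwartz_space :: "(real^'d::finite \<Rightarrow> complex) set" where
  "schwartz_space = {f. smooth f \<and>
     (\<forall>\<alpha> is. bounded (range (\<lambda>x. monomial \<alpha> x *\<^sub>R iterated_partial is f x)))}"

definition schwartz_seminorm ::
    "('d::finite \<Rightarrow> nat) \<Rightarrow> 'd list \<Rightarrow> (real^'d \<Rightarrow> complex) \<Rightarrow> real" where
  "schwartz_seminorm \<alpha> is f = (SUP x. norm (monomial \<alpha> x *\<^sub>R iterated_partial is f x))"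

definition schwartz_topology :: "(real^'d::finite \<Rightarrow> complex) topology" where
  "schwartz_topology = topology_generated_by
     {{f \<in> schwartz_space. schwartz_seminorm \<alpha> is (\<lambda>x. f x - g x) < r} | \<alpha> is g r.
        g \<in> schwartz_space \<and> 0 < r}"

definition fourier :: "(real^'d::finite \<Rightarrow> complex) \<Rightarrow> real^'d \<Rightarrow> complex" where
  "fourier m \<omega> = (LINT t|lborel. exp (- 2 * of_real pi * \<i> * of_real (t \<bullet> \<omega>)) * m t)"

definition reflect :: "(real^'d::finite \<Rightarrow> complex) \<Rightarrow> real^'d \<Rightarrow> complex" where
  "reflect g = (\<lambda>t. g (- t))"

definition conj_fun :: "(real^'d::finite \<Rightarrow> complex) \<Rightarrow> real^'d \<Rightarrow> complex" where
  "conj_fun g = (\<lambda>t. cnj (g t))"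

definition convolve ::
    "(real^'d::finite \<Rightarrow> complex) \<Rightarrow> (real^'d \<Rightarrow> complex) \<Rightarrow> real^'d \<Rightarrow> complex" where
  "convolve f g x = (LINT y|lborel. f y * g (x - y))"


section \<open>Tempered distributions\<close>

text \<open>
  A tempered distribution is a functional whose values outside \<open>schwartz_space\<close> are
  irrelevant; accordingly, equality of distributions is \<open>dist_eq\<close>.
  The duality is bilinear: a function \<open>f\<close> acts as \<open>\<phi> \<mapsto> \<integral> f \<phi>\<close>.
\<close>

type_synonym 'd functional = "(real^'d \<Rightarrow> complex) \<Rightarrow> complex"

definition tempered_distributions :: "'d::finite functional set" where
  "tempered_distributions = {T.
     (\<forall>\<phi>\<in>schwartz_space. \<forall>\<psi>\<in>schwartz_space. \<forall>a b.
        T (\<lambda>x. a * \<phi> x + b * \<psi> x) = a * T \<phi> + b * T \<psi>) \<and>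
     continuous_map schwartz_topology euclidean T}"

definition dist_eq :: "'d::finite functional \<Rightarrow> 'd functional \<Rightarrow> bool" (infix "=\<^sub>S" 50) where
  "T =\<^sub>S U \<longleftrightarrow> (\<forall>\<phi>\<in>schwartz_space. T \<phi> = U \<phi>)"

definition dist_of_fun :: "(real^'d::finite \<Rightarrow> complex) \<Rightarrow> 'd functional" where
  "dist_of_fun f = (\<lambda>\<phi>. LINT x|lborel. f x * \<phi> x)"

definition dist_mult :: "(real^'d::finite \<Rightarrow> complex) \<Rightarrow> 'd functional \<Rightarrow> 'd functional" where
  "dist_mult h T = (\<lambda>\<phi>. T (\<lambda>x. h x * \<phi> x))"

definition dist_reflect :: "'d::finite functional \<Rightarrow> 'd functional" where
  "dist_reflect T = (\<lambda>\<phi>. T (reflect \<phi>))"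

definition dist_conj :: "'d::finite functional \<Rightarrow> 'd functional" where
  "dist_conj T = (\<lambda>\<phi>. cnj (T (conj_fun \<phi>)))"

text \<open>
  The convolution of a Schwartz function \<open>f\<close> and a tempered distribution \<open>T\<close>, in either
  order, is the transpose of \<open>\<phi> \<mapsto> reflect f * \<phi>\<close>.
\<close>

definition convolve_fun_dist :: "(real^'d::finite \<Rightarrow> complex) \<Rightarrow> 'd functional \<Rightarrow> 'd functional" where
  "convolve_fun_dist f T = (\<lambda>\<phi>. T (convolve (reflect f) \<phi>))"

definition convolve_dist_fun :: "'d::finite functional \<Rightarrow> (real^'d \<Rightarrow> complex) \<Rightarrow> 'd functional" where
  "convolve_dist_fun T f = convolve_fun_dist f T"


section \<open>The window correlation function\<close>

text \<open>
  \<open>(reflect g\<^sub>2) * (cnj g\<^sub>1)\<close>, once for a distribution \<open>g\<^sub>1\<close> and a function \<open>g\<^sub>2\<close>,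
  once for a function \<open>g\<^sub>1\<close> and a distribution \<open>g\<^sub>2\<close>.
\<close>

definition window_corr_dist_fun ::
    "'d::finite functional \<Rightarrow> (real^'d \<Rightarrow> complex) \<Rightarrow> 'd functional" where
  "window_corr_dist_fun g\<^sub>1 g\<^sub>2 = convolve_fun_dist (reflect g\<^sub>2) (dist_conj g\<^sub>1)"

definition window_corr_fun_dist ::
    "(real^'d::finite \<Rightarrow> complex) \<Rightarrow> 'd functional \<Rightarrow> 'd functional" where
  "window_corr_fun_dist g\<^sub>1 g\<^sub>2 = convolve_dist_fun (dist_reflect g\<^sub>2) (conj_fun g\<^sub>1)"

end

theory Submission
  imports Defs
begin

text \<open>
  A window correlation function \<open>C\<close> is a continuous linear functional on Schwartz functions,
  being the composition of a tempered distribution with convolution by a Schwartz function.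
  If \<open>C = 1\<close>, evaluate both sides at the Schwartz function \<open>fourier m * \<phi>\<close>. Conversely, take
  a Schwartz function \<open>m\<close> with integral \<open>1\<close> (a normalised Gaussian). Its \<open>L\<^sup>1\<close>-dilates have Fourier
  transforms \<open>fourier m (x / n)\<close>, and \<open>(fourier m (x / n) - 1) * \<phi> x\<close> tends to \<open>0\<close> in the
  Schwartz space as \<open>n\<close> grows, at rate \<open>1 / n\<close> in every seminorm, because \<open>fourier m 0 = 1\<close> and
  each derivative of the dilate gains a factor \<open>1 / n\<close>. The hypothesis says that
  \<open>C - 1\<close> vanishes on \<open>fourier m (x / n) * \<phi> x\<close>, so it vanishes on the limit \<open>\<phi>\<close>.
\<close>

section \<open>Derivatives of smooth functions\<close>

text \<open>The obstacle is that the constant 1 is not the Fourier transform of a Schwartz function,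
  so the hypothesis only reaches approximations of 1, and these are not uniformly close to 1 on the
  whole space: the available bound on \<open>fourier m (x / n) - 1\<close> is of size
  \<open>norm x / n\<close>. This linear growth is paid for by one extra power of the weight
  \<open>1 + norm x\<close> on \<phi>. The transform enters as a multiplier with bounded derivatives
  of every order, which come from the moments of \<open>m\<close>; the decay of each product comes
  from \<phi>.

  Continuity in the generated topology is converted once into convergence along sequences with rate
  \<open>1 / (n + 1)\<close>. That rate is the one the dilates produce, and it survives conjugation,
  reflection and convolution because the estimates for these operations are linear in the bounds of
  their argument.\<close>

lemma partial_derivative_eq:
  assumes "(f has_derivative D) (at x)"
  shows "partial_derivative i f x = D (axis i 1)"
proof -
  have "((\<lambda>t. f (x + t *\<^sub>R axis i 1)) has_derivative (\<lambda>t. D (t *\<^sub>R axis i 1))) (at 0)"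
    by (rule has_derivative_compose[where g = f and f' = "\<lambda>t. t *\<^sub>R axis i 1"])
      (use assms in \<open>auto intro!: derivative_eq_intros\<close>)
  then have "((\<lambda>t. f (x + t *\<^sub>R axis i 1)) has_vector_derivative D (axis i 1)) (at 0)"
    unfolding has_vector_derivative_def
    using has_derivative_linear[OF assms] by (simp add: linear_scale)
  then show ?thesis
    unfolding partial_derivative_def by (rule vector_derivative_at)
qed

lemma axis_expansion: "(\<Sum>i\<in>UNIV. v $ i *\<^sub>R axis i 1) = (v::real^'d::finite)"
  using basis_expansion[of v] by (simp add: scalar_mult_eq_scaleR)

lemma has_derivative_partial:
  fixes f :: "real^'d::finite \<Rightarrow> complex"
  assumes "f differentiable at x"
  shows "(f has_derivative (\<lambda>v. \<Sum>i\<in>UNIV. v $ i *\<^sub>R partial_derivative i f x)) (at x)"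
proof -
  obtain D where D: "(f has_derivative D) (at x)"
    using assms by (auto simp: differentiable_def)
  have l: "linear D" by (rule has_derivative_linear[OF D])
  have "D v = (\<Sum>i\<in>UNIV. v $ i *\<^sub>R partial_derivative i f x)" for v
  proof -
    have "D v = D (\<Sum>i\<in>UNIV. v $ i *\<^sub>R axis i 1)"
      by (simp only: axis_expansion)
    then show ?thesis
      by (simp add: linear_sum[OF l] linear_scale[OF l] partial_derivative_eq[OF D])
  qed
  then have "D = (\<lambda>v. \<Sum>i\<in>UNIV. v $ i *\<^sub>R partial_derivative i f x)" by (rule ext)
  with D show ?thesis by (rule back_subst)
qed

lemma smooth_iterated_partial_differentiable:
  "smooth f \<Longrightarrow> iterated_partial is f differentiable at x"
  by (simp add: smooth_def)

lemma smooth_has_derivative: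
  assumes "smooth f"
  shows "(iterated_partial is f has_derivative
    (\<lambda>v. \<Sum>i\<in>UNIV. v $ i *\<^sub>R iterated_partial (i # is) f x)) (at x)"
  using has_derivative_partial[OF smooth_iterated_partial_differentiable[OF assms]] by simp

lemma smooth_continuous_on: "smooth f \<Longrightarrow> continuous_on A (iterated_partial is f)"
  by (meson continuous_at_imp_continuous_on differentiable_imp_continuous_within smooth_def)

lemma iterated_partial_append:
  "iterated_partial (is @ js) f = iterated_partial is (iterated_partial js f)"
  by (induction "is") auto

lemma smooth_iterated_partial: "smooth f \<Longrightarrow> smooth (iterated_partial js f)"
  unfolding smooth_def by (metis iterated_partial_append)

text \<open>By induction on the list: a total derivative of \<open>F is\<close> identifies its
  partial derivatives with the next members of the family. Formulas for linear combinations,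
  dilates, products, convolutions and Fourier transforms then follow by guessing \<open>F\<close>
  and checking one differentiation step.\<close>

lemma iterated_partial_eqI:
  assumes "F [] = f"
    and "\<And>is x. (F is has_derivative D is x) (at x)"
    and "\<And>i is x. D is x (axis i 1) = F (i # is) x"
  shows "iterated_partial is f = F is"
  by (induction "is") (auto simp: assms partial_derivative_eq[OF assms(2)])

text \<open>The same family yields smoothness, since every iterated partial is some
  \<open>F is\<close> and therefore has a total derivative.\<close>

lemma smoothI:
  assumes "F [] = f"
    and "\<And>is x. (F is has_derivative D is x) (at x)"
    and "\<And>i is x. D is x (axis i 1) = F (i # is) x"
  shows "smooth f"
  unfolding smooth_def differentiable_def
  using assms(2) iterated_partial_eqI[of F f D, OF assms] by metis

lemma axis_sum_scaleR:
  "(\<Sum>j\<in>UNIV. axis (i::'d::finite) (1::real) $ j *\<^sub>R g j) = (g i :: 'a::real_vector)"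
proof -
  have "(\<Sum>j\<in>UNIV. axis i (1::real) $ j *\<^sub>R g j) = (\<Sum>j\<in>UNIV. if j = i then g j else 0)"
    by (intro sum.cong) (auto simp: axis_def)
  then show ?thesis by simp
qed

lemma
  fixes f g :: "real^'d::finite \<Rightarrow> complex"
  assumes f: "smooth f" and g: "smooth g"
  shows iterated_partial_linear: "iterated_partial is (\<lambda>x. a * f x + b * g x) =
      (\<lambda>x. a * iterated_partial is f x + b * iterated_partial is g x)" (is ?A)
    and smooth_linear: "smooth (\<lambda>x. a * f x + b * g x)" (is ?B)
proof -
  define F where "F is = (\<lambda>x. a * iterated_partial is f x + b * iterated_partial is g x)" for "is"
  define D where "D is x = (\<lambda>v. a * (\<Sum>i\<in>UNIV. v $ i *\<^sub>R iterated_partial (i # is) f x)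
     + b * (\<Sum>i\<in>UNIV. v $ i *\<^sub>R iterated_partial (i # is) g x))" for "is" and x :: "real^'d"
  have F: "F [] = (\<lambda>x. a * f x + b * g x)" by (simp add: F_def)
  have 1: "(F is has_derivative D is x) (at x)" for "is" x
    unfolding F_def D_def
    by (intro has_derivative_add has_derivative_mult_right smooth_has_derivative f g)
  have 2: "D is x (axis i 1) = F (i # is) x" for i "is" x
    unfolding F_def D_def axis_sum_scaleR ..
  show ?A using iterated_partial_eqI[of F _ D, OF F 1 2] by (simp add: F_def)
  show ?B by (rule smoothI[of F _ D, OF F 1 2])
qed

lemma
  fixes f :: "real^'d::finite \<Rightarrow> complex"
  assumes f: "smooth f"
  shows iterated_partial_scale: "iterated_partial is (\<lambda>x. f (c *\<^sub>R x)) =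
      (\<lambda>x. c ^ length is *\<^sub>R iterated_partial is f (c *\<^sub>R x))" (is ?A)
    and smooth_scale: "smooth (\<lambda>x. f (c *\<^sub>R x))" (is ?B)
proof -
  define F where "F is = (\<lambda>x. c ^ length is *\<^sub>R iterated_partial is f (c *\<^sub>R x))" for "is"
  define D where "D is x = (\<lambda>v. c ^ length is *\<^sub>R
     (\<Sum>i\<in>UNIV. (c *\<^sub>R v) $ i *\<^sub>R iterated_partial (i # is) f (c *\<^sub>R x)))"
    for "is" and x :: "real^'d"
  have F: "F [] = (\<lambda>x. f (c *\<^sub>R x))" by (simp add: F_def)
  have 1: "(F is has_derivative D is x) (at x)" for "is" x
    unfolding F_def D_def
    by (intro has_derivative_scaleR_right
        has_derivative_compose[OF _ smooth_has_derivative[OF f]] has_derivative_ident)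
  have 2: "D is x (axis i 1) = F (i # is) x" for i "is" x
  proof -
    have "(\<Sum>j\<in>UNIV. (c *\<^sub>R axis i 1) $ j *\<^sub>R iterated_partial (j # is) f (c *\<^sub>R x)) =
       c *\<^sub>R (\<Sum>j\<in>UNIV. axis i 1 $ j *\<^sub>R iterated_partial (j # is) f (c *\<^sub>R x))"
      by (simp only: scaleR_sum_right vector_scaleR_component scaleR_scaleR real_scaleR_def)
    then show ?thesis unfolding F_def D_def axis_sum_scaleR
      by (simp add: mult.commute)
  qed
  show ?A using iterated_partial_eqI[of F _ D, OF F 1 2] by (simp add: F_def)
  show ?B by (rule smoothI[of F _ D, OF F 1 2])
qed

lemma
  fixes f :: "real^'d::finite \<Rightarrow> complex"
  assumes f: "smooth f"
  shows iterated_partial_conj_fun: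
      "iterated_partial is (conj_fun f) = conj_fun (iterated_partial is f)" (is ?A)
    and smooth_conj_fun: "smooth (conj_fun f)" (is ?B)
proof -
  define F where "F is = conj_fun (iterated_partial is f)" for "is"
  define D where "D is x = (\<lambda>v. cnj (\<Sum>i\<in>UNIV. v $ i *\<^sub>R iterated_partial (i # is) f x))"
    for "is" and x :: "real^'d"
  have F: "F [] = conj_fun f" by (simp add: F_def)
  have 1: "(F is has_derivative D is x) (at x)" for "is" x
    unfolding F_def D_def conj_fun_def
    by (intro has_derivative_cnj smooth_has_derivative f)
  have 2: "D is x (axis i 1) = F (i # is) x" for i "is" x
    unfolding F_def D_def axis_sum_scaleR conj_fun_def ..
  show ?A using iterated_partial_eqI[of F _ D, OF F 1 2] by (simp add: F_def)
  show ?B by (rule smoothI[of F _ D, OF F 1 2])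
qed

text \<open>All ways to distribute the differentiations of a product over its two factors. Equal
  splits are kept with multiplicity in a list, which replaces the binomial coefficients of the
  Leibniz rule.\<close>

primrec leibniz_splits :: "'a list \<Rightarrow> ('a list \<times> 'a list) list" where
  "leibniz_splits [] = [([], [])]"
| "leibniz_splits (i # is) = map (\<lambda>(a, b). (i # a, b)) (leibniz_splits is) @
     map (\<lambda>(a, b). (a, i # b)) (leibniz_splits is)"

lemma has_derivative_sum_list:
  assumes "\<And>p. p \<in> set ps \<Longrightarrow> (f p has_derivative f' p) F"
  shows "((\<lambda>x. \<Sum>p\<leftarrow>ps. f p x) has_derivative (\<lambda>v. \<Sum>p\<leftarrow>ps. f' p v)) F"
  using assms by (induction ps) (auto intro!: derivative_intros)

lemma
  fixes f g :: "real^'d::finite \<Rightarrow> complex"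
  assumes f: "smooth f" and g: "smooth g"
  shows iterated_partial_mult: "iterated_partial is (\<lambda>x. f x * g x) =
      (\<lambda>x. \<Sum>p\<leftarrow>leibniz_splits is. iterated_partial (fst p) f x * iterated_partial (snd p) g x)"
      (is ?A)
    and smooth_mult: "smooth (\<lambda>x. f x * g x)" (is ?B)
proof -
  define F where "F is = (\<lambda>x. \<Sum>p\<leftarrow>leibniz_splits is.
    iterated_partial (fst p) f x * iterated_partial (snd p) g x)" for "is"
  define D where "D is x = (\<lambda>v. \<Sum>p\<leftarrow>leibniz_splits is.
      iterated_partial (fst p) f x * (\<Sum>i\<in>UNIV. v $ i *\<^sub>R iterated_partial (i # snd p) g x) +
      (\<Sum>i\<in>UNIV. v $ i *\<^sub>R iterated_partial (i # fst p) f x) * iterated_partial (snd p) g x)"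
    for "is" and x :: "real^'d"
  have F: "F [] = (\<lambda>x. f x * g x)" by (simp add: F_def)
  have 1: "(F is has_derivative D is x) (at x)" for "is" x
    unfolding F_def D_def
    by (intro has_derivative_sum_list has_derivative_mult smooth_has_derivative f g)
  have 2: "D is x (axis i 1) = F (i # is) x" for i "is" x
    unfolding F_def D_def axis_sum_scaleR
    by (simp add: sum_list_addf o_def case_prod_unfold)
  show ?A using iterated_partial_eqI[of F _ D, OF F 1 2] by (simp add: F_def)
  show ?B by (rule smoothI[of F _ D, OF F 1 2])
qed

lemma
  fixes c :: complex
  shows iterated_partial_const:
    "iterated_partial is (\<lambda>x::real^'d::finite. c) = (\<lambda>x. if is = [] then c else 0)" (is ?A)
    and smooth_const: "smooth (\<lambda>x::real^'d. c)" (is ?B)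
proof -
  define F where "F is = (\<lambda>x::real^'d. if is = [] then c else 0)" for "is" :: "'d list"
  define D where "D is x = (\<lambda>v::real^'d. 0::complex)" for "is" :: "'d list" and x :: "real^'d"
  have F: "F [] = (\<lambda>x. c)" by (simp add: F_def)
  have 1: "(F is has_derivative D is x) (at x)" for "is" x
    unfolding F_def D_def by (rule has_derivative_const)
  have 2: "D is x (axis i 1) = F (i # is) x" for i "is" x
    unfolding F_def D_def by simp
  show ?A using iterated_partial_eqI[of F _ D, OF F 1 2] by (simp add: F_def)
  show ?B by (rule smoothI[of F _ D, OF F 1 2])
qed

section \<open>Schwartz functions\<close>

lemma norm_monomial_le:
  fixes x :: "real^'d::finite"
  shows "\<bar>monomial \<alpha> x\<bar> \<le> (1 + norm x) ^ (\<Sum>i\<in>UNIV. \<alpha> i)"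
proof -
  have "\<bar>monomial \<alpha> x\<bar> = (\<Prod>i\<in>UNIV. \<bar>x $ i\<bar> ^ \<alpha> i)"
    by (simp add: monomial_def abs_prod power_abs)
  also have "\<dots> \<le> (\<Prod>i\<in>UNIV. (1 + norm x) ^ \<alpha> i)"
    by (intro prod_mono conjI power_mono) (auto intro: order_trans[OF component_le_norm_cart])
  also have "\<dots> = (1 + norm x) ^ (\<Sum>i\<in>UNIV. \<alpha> i)"
    by (simp add: power_sum)
  finally show ?thesis .
qed

text \<open>The coordinate of largest modulus \<open>M\<close> controls the norm through the l1
  bound, and its pure \<open>k\<close>-th power occurs in the sum. The leading 1 covers the case
  \<open>M < 1\<close>.\<close>

lemma weight_le_monomials:
  fixes x :: "real^'d::finite"
  shows "(1 + norm x) ^ k \<le>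
    (1 + real CARD('d)) ^ k * (1 + (\<Sum>i\<in>UNIV. \<bar>monomial (\<lambda>j. if j = i then k else 0) x\<bar>))"
proof -
  define M where "M = Max (range (\<lambda>i. \<bar>x $ i\<bar>))"
  have M: "\<bar>x $ i\<bar> \<le> M" for i
    unfolding M_def by (rule Max_ge) auto
  have "M \<in> range (\<lambda>i. \<bar>x $ i\<bar>)"
    unfolding M_def by (rule Max_in) auto
  then obtain i where i: "M = \<bar>x $ i\<bar>" by auto
  have mon: "monomial (\<lambda>j. if j = i then k else 0) x = (x $ i) ^ k"
    unfolding monomial_def by (subst prod.remove[of _ i]) auto
  have "norm x \<le> (\<Sum>j\<in>UNIV. \<bar>x $ j\<bar>)" by (rule norm_le_l1_cart)
  also have "\<dots> \<le> real CARD('d) * M"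
    using sum_bounded_above[of UNIV "\<lambda>j. \<bar>x $ j\<bar>" M] M by simp
  also have "\<dots> \<le> real CARD('d) * max 1 M"
    by (intro mult_left_mono) auto
  finally have "1 + norm x \<le> (1 + real CARD('d)) * max 1 M"
    by (auto simp: distrib_right)
  then have "(1 + norm x) ^ k \<le> ((1 + real CARD('d)) * max 1 M) ^ k"
    by (intro power_mono) auto
  also have "\<dots> = (1 + real CARD('d)) ^ k * (max 1 M) ^ k"
    by (simp add: power_mult_distrib)
  also have "(max 1 M) ^ k \<le> 1 + \<bar>x $ i\<bar> ^ k"
    by (auto simp: max_def i)
  also have "\<bar>x $ i\<bar> ^ k = \<bar>monomial (\<lambda>j. if j = i then k else 0) x\<bar>"
    by (simp add: mon power_abs)
  also have "\<dots> \<le> (\<Sum>i\<in>UNIV. \<bar>monomial (\<lambda>j. if j = i then k else 0) x\<bar>)"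
    by (rule member_le_sum[of _ _ "\<lambda>i. \<bar>monomial (\<lambda>j. if j = i then k else 0) x\<bar>"]) auto
  finally show ?thesis by (simp add: mult_left_mono)
qed

lemma schwartz_smooth: "f \<in> schwartz_space \<Longrightarrow> smooth f"
  by (simp add: schwartz_space_def)

text \<open>Trades the family of monomial seminorms for one radial weight, which behaves well under
  dilation and, being submultiplicative, under convolution. \<open>schwartzI\<close> is the way
  back.\<close>

lemma schwartz_decay:
  fixes f :: "real^'d::finite \<Rightarrow> complex"
  assumes "f \<in> schwartz_space"
  obtains C where "C \<ge> 0" "\<And>x. (1 + norm x) ^ k * norm (iterated_partial is f x) \<le> C"
proof -
  have "\<exists>C. \<forall>x. \<bar>monomial \<alpha> x\<bar> * norm (iterated_partial is f x) \<le> C" for \<alpha>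
    using assms unfolding schwartz_space_def bounded_iff by force
  then obtain B where B: "\<And>\<alpha> x. \<bar>monomial \<alpha> x\<bar> * norm (iterated_partial is f x) \<le> B \<alpha>"
    by metis
  have m0: "monomial (\<lambda>_. 0) x = 1" for x :: "real^'d" by (simp add: monomial_def)
  define C where "C = (1 + real CARD('d)) ^ k *
    (B (\<lambda>_. 0) + (\<Sum>i\<in>UNIV. B (\<lambda>j. if j = i then k else 0)))"
  have *: "(1 + norm x) ^ k * norm (iterated_partial is f x) \<le> C" for x
  proof -
    have "(1 + norm x) ^ k * norm (iterated_partial is f x) \<le> (1 + real CARD('d)) ^ k *
      (1 + (\<Sum>i\<in>UNIV. \<bar>monomial (\<lambda>j. if j = i then k else 0) x\<bar>)) * norm (iterated_partial is f x)"
      by (intro mult_right_mono weight_le_monomials) auto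
    also have "\<dots> = (1 + real CARD('d)) ^ k * (\<bar>monomial (\<lambda>_. 0) x\<bar> * norm (iterated_partial is f x)
       + (\<Sum>i\<in>UNIV. \<bar>monomial (\<lambda>j. if j = i then k else 0) x\<bar> * norm (iterated_partial is f x)))"
      by (simp add: m0 sum_distrib_right distrib_right)
    also have "\<dots> \<le> C"
      unfolding C_def by (intro mult_left_mono add_mono sum_mono B) auto
    finally show ?thesis .
  qed
  moreover have "0 \<le> C" by (rule order_trans[OF _ *[of 0]]) auto
  ultimately show thesis using that by blast
qed

lemma schwartzI:
  fixes f :: "real^'d::finite \<Rightarrow> complex"
  assumes "smooth f"
    and "\<And>k is. \<exists>C. \<forall>x. (1 + norm x) ^ k * norm (iterated_partial is f x) \<le> C"
  shows "f \<in> schwartz_space"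
proof -
  have "bounded (range (\<lambda>x. monomial \<alpha> x *\<^sub>R iterated_partial is f x))" for \<alpha> "is"
  proof -
    obtain C where C: "\<And>x. (1 + norm x) ^ (\<Sum>i\<in>UNIV. \<alpha> i) * norm (iterated_partial is f x) \<le> C"
      using assms(2) by blast
    have "norm (monomial \<alpha> x *\<^sub>R iterated_partial is f x) \<le> C" for x
      using mult_right_mono[OF norm_monomial_le norm_ge_zero] C[of x]
      by (metis norm_scaleR order_trans real_norm_def)
    then show ?thesis unfolding bounded_iff by blast
  qed
  then show ?thesis using assms(1) by (simp add: schwartz_space_def)
qed

section \<open>Closure of the Schwartz space under elementary operations\<close>

lemma schwartz_linear:
  fixes f g :: "real^'d::finite \<Rightarrow> complex"
  assumes "f \<in> schwartz_space" "g \<in> schwartz_space"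
  shows "(\<lambda>x. a * f x + b * g x) \<in> schwartz_space"
proof (rule schwartzI)
  note sm = schwartz_smooth[OF assms(1)] schwartz_smooth[OF assms(2)]
  show "smooth (\<lambda>x. a * f x + b * g x)" by (intro smooth_linear sm)
  fix k and "is" :: "'d list"
  obtain C where C: "C \<ge> 0" "\<And>x. (1 + norm x) ^ k * norm (iterated_partial is f x) \<le> C"
    by (rule schwartz_decay[OF assms(1)]) blast
  obtain D where D: "D \<ge> 0" "\<And>x. (1 + norm x) ^ k * norm (iterated_partial is g x) \<le> D"
    by (rule schwartz_decay[OF assms(2)]) blast
  have "(1 + norm x) ^ k * norm (iterated_partial is (\<lambda>x. a * f x + b * g x) x)
    \<le> norm a * C + norm b * D" for x
  proof -
    have "norm (iterated_partial is (\<lambda>x. a * f x + b * g x) x)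
      \<le> norm a * norm (iterated_partial is f x) + norm b * norm (iterated_partial is g x)"
      unfolding iterated_partial_linear[OF sm] norm_mult[symmetric] by (rule norm_triangle_ineq)
    then have "(1 + norm x) ^ k * norm (iterated_partial is (\<lambda>x. a * f x + b * g x) x)
      \<le> (1 + norm x) ^ k * (norm a * norm (iterated_partial is f x)
          + norm b * norm (iterated_partial is g x))"
      by (intro mult_left_mono) auto
    also have "\<dots> = norm a * ((1 + norm x) ^ k * norm (iterated_partial is f x))
      + norm b * ((1 + norm x) ^ k * norm (iterated_partial is g x))"
      by (simp add: algebra_simps)
    also have "\<dots> \<le> norm a * C + norm b * D"
      by (intro add_mono mult_left_mono C D) auto
    finally show ?thesis .
  qed
  then show "\<exists>C. \<forall>x. (1 + norm x) ^ k *
     norm (iterated_partial is (\<lambda>x. a * f x + b * g x) x) \<le> C" by blast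
qed

lemma schwartz_diff:
  assumes "f \<in> schwartz_space" "g \<in> schwartz_space"
  shows "(\<lambda>x. f x - g x) \<in> schwartz_space"
  using schwartz_linear[OF assms, of 1 "-1"] by simp

lemma schwartz_zero: "(\<lambda>x. 0) \<in> schwartz_space"
  by (rule schwartzI[OF smooth_const]) (auto simp: iterated_partial_const)

lemma schwartz_iterated_partial:
  assumes "f \<in> schwartz_space"
  shows "iterated_partial js f \<in> schwartz_space"
proof (rule schwartzI)
  show "smooth (iterated_partial js f)"
    by (intro smooth_iterated_partial schwartz_smooth assms)
  show "\<exists>C. \<forall>x. (1 + norm x) ^ k * norm (iterated_partial is (iterated_partial js f) x) \<le> C" for k "is"
    unfolding iterated_partial_append[symmetric]
    by (rule schwartz_decay[OF assms]) blast
qed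

lemma schwartz_conj_fun:
  assumes "f \<in> schwartz_space"
  shows "conj_fun f \<in> schwartz_space"
proof (rule schwartzI)
  note sm = schwartz_smooth[OF assms]
  show "smooth (conj_fun f)" by (intro smooth_conj_fun sm)
  show "\<exists>C. \<forall>x. (1 + norm x) ^ k * norm (iterated_partial is (conj_fun f) x) \<le> C" for k "is"
    unfolding iterated_partial_conj_fun[OF sm] unfolding conj_fun_def complex_mod_cnj
    by (rule schwartz_decay[OF assms]) blast
qed

lemma weight_scale_le:
  fixes x :: "'a::real_normed_vector"
  assumes "1 \<le> \<bar>c\<bar>"
  shows "(1 + norm x) ^ k \<le> (1 + norm (c *\<^sub>R x)) ^ k"
  using mult_right_mono[OF assms norm_ge_zero[of x]] by (intro power_mono) auto

text \<open>For \<open>\<bar>c\<bar> \<ge> 1\<close> the weight at \<open>x\<close> is at most the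
  weight at \<open>c *\<^sub>R x\<close>, so the decay constant survives up to the chain rule
  factor. This covers reflection and the dilations by \<open>Suc n\<close>.\<close>

lemma schwartz_scale:
  assumes "f \<in> schwartz_space" and c: "1 \<le> \<bar>c\<bar>"
  shows "(\<lambda>x. f (c *\<^sub>R x)) \<in> schwartz_space"
proof (rule schwartzI)
  note sm = schwartz_smooth[OF assms(1)]
  show "smooth (\<lambda>x. f (c *\<^sub>R x))" by (intro smooth_scale sm)
  fix k "is"
  obtain C where C: "C \<ge> 0" "\<And>x. (1 + norm x) ^ k * norm (iterated_partial is f x) \<le> C"
    by (rule schwartz_decay[OF assms(1)]) blast
  have "(1 + norm x) ^ k * norm (iterated_partial is (\<lambda>x. f (c *\<^sub>R x)) x)
    \<le> \<bar>c\<bar> ^ length is * C" for x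
  proof -
    have "(1 + norm x) ^ k * norm (iterated_partial is f (c *\<^sub>R x)) \<le> C"
      by (rule order_trans[OF mult_right_mono[OF weight_scale_le[OF c] norm_ge_zero] C(2)])
    from mult_left_mono[OF this, of "\<bar>c\<bar> ^ length is"]
    show ?thesis
      unfolding iterated_partial_scale[OF sm] by (simp add: power_abs mult.left_commute)
  qed
  then show "\<exists>C. \<forall>x. (1 + norm x) ^ k *
     norm (iterated_partial is (\<lambda>x. f (c *\<^sub>R x)) x) \<le> C" by blast
qed

lemma schwartz_reflect: "f \<in> schwartz_space \<Longrightarrow> reflect f \<in> schwartz_space"
  using schwartz_scale[of f "-1"] by (simp add: reflect_def)

lemma iterated_partial_reflect:
  "smooth f \<Longrightarrow> iterated_partial is (reflect f) = (\<lambda>x. (-1) ^ length is *\<^sub>R iterated_partial is f (- x))"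
  using iterated_partial_scale[of f "is" "-1"] by (simp add: reflect_def)

section \<open>Integrability against polynomial weights\<close>

text \<open>The proof covers the space by balls of integer radius, whose volumes grow polynomially.\<close>

lemma weight_integrable:
  "\<exists>k. integrable lborel (\<lambda>x::'a::euclidean_space. 1 / (1 + norm x) ^ k)"
proof (intro exI integrableI_bounded)
  let ?d = "DIM('a)"
  \<comment> \<open>A ball of radius \<open>n + 1\<close> has volume proportional to
    \<open>(n + 1) ^ d\<close>, so the exponent \<open>d + 2\<close> leaves the summable
    \<open>1 / (n + 1) ^ 2\<close>.\<close>
  let ?k = "?d + 2"
  show "(\<lambda>x::'a. 1 / (1 + norm x) ^ ?k) \<in> borel_measurable lborel" by measurable
  define V where "V = unit_ball_vol (real ?d)"
  define a where "a n = (1 / real (Suc n) ^ 2) * (2 ^ ?d * V)" for n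
  have V0: "V \<ge> 0" unfolding V_def by (rule unit_ball_vol_nonneg) auto
  have pt: "ennreal (norm (1 / (1 + norm x) ^ ?k)) \<le>
     (\<Sum>n. ennreal (1 / real (Suc n) ^ ?k) * indicator (cball 0 (real (Suc n))) x)" for x :: 'a
  proof -
    define g :: "nat \<Rightarrow> ennreal"
      where "g n = ennreal (1 / real (Suc n) ^ ?k) * indicator (cball 0 (real (Suc n))) x" for n
    \<comment> \<open>With this \<open>n\<close>, the point \<open>x\<close> lies in the ball of
      radius \<open>n + 1\<close> while its weight is at least \<open>(n + 1) ^ ?k\<close>; this one
      term of the series already dominates.\<close>
    define n where "n = nat \<lfloor>norm x\<rfloor>"
    have n: "real n \<le> norm x" "norm x \<le> real (Suc n)"
      unfolding n_def by (simp, linarith)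
    have "real (Suc n) ^ ?k \<le> (1 + norm x) ^ ?k"
      using n by (intro power_mono) auto
    moreover have "0 < (1 + norm x) ^ ?k" by (simp add: add_pos_nonneg)
    ultimately have "ennreal (norm (1 / (1 + norm x) ^ ?k)) \<le> ennreal (1 / real (Suc n) ^ ?k)"
      by (intro ennreal_leI) (simp add: frac_le del: power_Suc)
    also have "\<dots> = g n" using n by (simp add: g_def dist_norm)
    also have "\<dots> = sum g {n}" by simp
    also have "\<dots> \<le> suminf g" by (rule sum_le_suminf[OF summableI]) auto
    also have "suminf g =
      (\<Sum>n. ennreal (1 / real (Suc n) ^ ?k) * indicator (cball 0 (real (Suc n))) x)"
      unfolding g_def ..
    finally show ?thesis .
  qed
  have "(\<integral>\<^sup>+ x. ennreal (norm (1 / (1 + norm (x::'a)) ^ ?k)) \<partial>lborel) \<le>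
    (\<integral>\<^sup>+ x. (\<Sum>n. ennreal (1 / real (Suc n) ^ ?k) * indicator (cball 0 (real (Suc n))) (x::'a)) \<partial>lborel)"
    by (rule nn_integral_mono[OF pt])
  also have "\<dots> = (\<Sum>n. \<integral>\<^sup>+ x. ennreal (1 / real (Suc n) ^ ?k) * indicator (cball 0 (real (Suc n))) (x::'a) \<partial>lborel)"
    by (intro nn_integral_suminf borel_measurable_times_ennreal borel_measurable_indicator) auto
  also have "\<dots> = (\<Sum>n. ennreal (1 / real (Suc n) ^ ?k) * ennreal (V * real (Suc n) ^ ?d))"
    by (simp add: nn_integral_cmult_indicator emeasure_cball V_def del: of_nat_Suc)
  also have "\<dots> = (\<Sum>n. ennreal (V * (1 / real (Suc n) ^ 2)))"
    using V0 by (intro suminf_cong) (simp add: ennreal_mult[symmetric] power_add power2_eq_square del: of_nat_Suc)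
  also have "\<dots> < \<infinity>"
  proof -
    have "summable (\<lambda>n. V * (1 / real (Suc n) ^ 2))"
      using inverse_power_summable[of 2, where 'a = real]
      by (intro summable_mult) (subst summable_Suc_iff, simp add: inverse_eq_divide)
    then show ?thesis using V0 by (simp add: suminf_ennreal2)
  qed
  finally show "(\<integral>\<^sup>+ x. ennreal (norm (1 / (1 + norm (x::'a)) ^ ?k)) \<partial>lborel) < \<infinity>" .
qed

lemma schwartz_measurable:
  assumes "f \<in> schwartz_space"
  shows "f \<in> borel_measurable borel"
  using smooth_continuous_on[OF schwartz_smooth[OF assms], of UNIV "[]"]
  by (auto intro: borel_measurable_continuous_onI)

lemma schwartz_integrable_weighted:
  fixes f :: "real^'d::finite \<Rightarrow> complex"
  assumes "f \<in> schwartz_space"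
  shows "integrable lborel (\<lambda>x. (1 + norm x) ^ k * norm (f x))"
proof -
  obtain l where l: "integrable lborel (\<lambda>x::real^'d. 1 / (1 + norm x) ^ l)"
    using weight_integrable by blast
  \<comment> \<open>Of the \<open>l + k\<close> powers, \<open>k\<close> cancel the weight in the
    claim and the spare \<open>l\<close> supply an integrable majorant.\<close>
  obtain C where C: "C \<ge> 0" "\<And>x. (1 + norm x) ^ (l + k) * norm (iterated_partial [] f x) \<le> C"
    by (rule schwartz_decay[OF assms]) blast
  have [measurable]: "f \<in> borel_measurable borel" by (rule schwartz_measurable[OF assms])
  show ?thesis
  proof (rule Bochner_Integration.integrable_bound[OF integrable_mult_right[OF l, of C]])
    show "AE x in lborel. norm ((1 + norm x) ^ k * norm (f x)) \<le> norm (C * (1 / (1 + norm x) ^ l))"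
    proof (intro AE_I2)
      fix x :: "real^'d"
      have "0 < (1 + norm x) ^ l" by (simp add: add_pos_nonneg)
      then show "norm ((1 + norm x) ^ k * norm (f x)) \<le> norm (C * (1 / (1 + norm x) ^ l))"
        using C(1) C(2)[of x] by (simp add: abs_mult power_add field_simps)
    qed
  qed measurable
qed

lemma schwartz_integrable:
  assumes "f \<in> schwartz_space"
  shows "integrable lborel f"
  using schwartz_integrable_weighted[OF assms, of 0] schwartz_measurable[OF assms]
  by (simp add: integrable_norm_iff)

section \<open>Convolution\<close>

lemma norm_sum_component_le:
  fixes a :: "'d::finite \<Rightarrow> 'a::real_normed_vector"
  assumes "\<And>i. norm (a i) \<le> B"
  shows "norm (\<Sum>i\<in>UNIV. (v::real^'d) $ i *\<^sub>R a i) \<le> real CARD('d) * B * norm v"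
proof -
  have "norm (\<Sum>i\<in>UNIV. v $ i *\<^sub>R a i) \<le> (\<Sum>i\<in>(UNIV::'d set). norm v * B)"
    by (intro sum_norm_le) (auto intro!: mult_mono assms component_le_norm_cart)
  then show ?thesis by (simp add: mult_ac)
qed

lemma smooth_lipschitz:
  fixes f :: "real^'d::finite \<Rightarrow> complex"
  assumes f: "smooth f" and B: "\<And>i x. norm (iterated_partial [i] f x) \<le> B"
  shows "norm (f x - f y) \<le> real CARD('d) * B * norm (x - y)"
proof (rule differentiable_bound[of UNIV])
  show "(f has_derivative (\<lambda>v. \<Sum>i\<in>UNIV. v $ i *\<^sub>R iterated_partial [i] f z)) (at z within UNIV)" for z
    using smooth_has_derivative[OF f, of "[]" z] by simp
  show "onorm (\<lambda>v. \<Sum>i\<in>UNIV. v $ i *\<^sub>R iterated_partial [i] f z) \<le> real CARD('d) * B" for z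
    by (rule onorm_le, rule norm_sum_component_le, rule B)
qed auto

text \<open>Bounded second derivatives make each first partial Lipschitz with constant
  \<open>CARD('d) * B\<close>. On the ball of radius \<open>norm v\<close> the derivative thus moves
  by at most \<open>(CARD('d))\<^sup>2 * B * norm v\<close> in operator norm, and linearising
  contributes the second factor \<open>norm v\<close>.\<close>

lemma smooth_quadratic_remainder:
  fixes f :: "real^'d::finite \<Rightarrow> complex"
  assumes f: "smooth f" and B: "\<And>i j x. norm (iterated_partial [i, j] f x) \<le> B"
  shows "norm (f (x + v) - f x - (\<Sum>i\<in>UNIV. v $ i *\<^sub>R iterated_partial [i] f x))
    \<le> (real CARD('d))\<^sup>2 * B * (norm v)\<^sup>2"
proof -
  let ?D = "\<lambda>z v. \<Sum>i\<in>UNIV. (v::real^'d) $ i *\<^sub>R iterated_partial [i] f z"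
  have B0: "0 \<le> B" using B[of undefined undefined x] norm_ge_zero order_trans by blast
  have "norm (f (x + v) - f x - ?D x (x + v - x))
    \<le> norm (x + v - x) * (real CARD('d) * (real CARD('d) * B * norm v))"
  proof (rule differentiable_bound_linearization[where S = "cball x (norm v)"])
    show "x + t *\<^sub>R (x + v - x) \<in> cball x (norm v)" if "t \<in> {0..1}" for t
      using that by (auto simp: dist_norm intro: mult_left_le_one_le)
    show "(f has_derivative ?D z) (at z within cball x (norm v))" for z
      using smooth_has_derivative[OF f, of "[]" z] by (simp add: has_derivative_at_withinI)
    fix z assume z: "z \<in> cball x (norm v)"
    have "norm (iterated_partial [i] f z - iterated_partial [i] f x) \<le> real CARD('d) * B * norm v" for i
    proof -
      have "norm (iterated_partial [i] f z - iterated_partial [i] f x) \<le> real CARD('d) * B * norm (z - x)"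
        by (rule smooth_lipschitz) (use B in \<open>auto intro: smooth_iterated_partial f simp del: iterated_partial.simps
           simp: iterated_partial_append[symmetric]\<close>)
      also have "\<dots> \<le> real CARD('d) * B * norm v"
        using z B0 by (intro mult_left_mono) (auto simp: dist_norm norm_minus_commute)
      finally show ?thesis .
    qed
    from norm_sum_component_le[OF this]
    show "onorm (?D z - ?D x) \<le> real CARD('d) * (real CARD('d) * B * norm v)"
      by (intro onorm_le) (simp add: fun_diff_def sum_subtractf[symmetric] scaleR_diff_right[symmetric]
          del: iterated_partial.simps)
  qed auto
  then show ?thesis by (simp add: power2_eq_square mult_ac)
qed

text \<open>
  The uniform quadratic bound on the Taylor remainder makes dominated convergence unnecessary.
\<close>

lemma has_derivative_integral_quadratic:
  fixes f :: "real^'d::finite \<Rightarrow> 'b \<Rightarrow> complex"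
  assumes f: "\<And>x. integrable M (f x)" and f': "\<And>i. integrable M (f' i)" and G: "integrable M G"
    and bound: "\<And>v y. norm (f (x + v) y - f x y - (\<Sum>i\<in>UNIV. v $ i *\<^sub>R f' i y)) \<le> G y * (norm v)\<^sup>2"
  shows "((\<lambda>x. LINT y|M. f x y) has_derivative (\<lambda>v. \<Sum>i\<in>UNIV. v $ i *\<^sub>R (LINT y|M. f' i y))) (at x)"
proof -
  define F where "F x = (LINT y|M. f x y)" for x
  define D where "D v = (\<Sum>i\<in>UNIV. v $ i *\<^sub>R (LINT y|M. f' i y))" for v :: "real^'d"
  define K where "K = (LINT y|M. G y)"
  have bl: "bounded_linear D"
    unfolding D_def
    by (intro bounded_linear_sum bounded_linear_compose[OF bounded_linear_scaleR_left]
        bounded_linear_vec_nth)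
  have est: "norm (F (x + v) - F x - D v) \<le> K * (norm v)\<^sup>2" for v
  proof -
    have int: "integrable M (\<lambda>y. f (x + v) y - f x y - (\<Sum>i\<in>UNIV. v $ i *\<^sub>R f' i y))"
      using f f' by (intro Bochner_Integration.integrable_diff Bochner_Integration.integrable_sum
          integrable_scaleR_right)
    have "F (x + v) - F x - D v =
       (LINT y|M. f (x + v) y - f x y - (\<Sum>i\<in>UNIV. v $ i *\<^sub>R f' i y))"
      unfolding F_def D_def using f f'
      by (simp add: Bochner_Integration.integral_diff Bochner_Integration.integral_sum)
    also have "norm \<dots> \<le> (LINT y|M. norm (f (x + v) y - f x y - (\<Sum>i\<in>UNIV. v $ i *\<^sub>R f' i y)))"
      by (rule integral_norm_bound)
    also have "\<dots> \<le> (LINT y|M. G y * (norm v)\<^sup>2)"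
      by (intro integral_mono integrable_norm int integrable_mult_left G bound)
    finally show ?thesis by (simp add: K_def)
  qed
  have "((\<lambda>h. norm (F (x + h) - F x - D h) / norm h) \<longlongrightarrow> 0) (at 0)"
  proof (rule tendsto_sandwich[OF _ _ tendsto_const])
    show "\<forall>\<^sub>F h in at 0. 0 \<le> norm (F (x + h) - F x - D h) / norm h" by simp
    show "\<forall>\<^sub>F h in at 0. norm (F (x + h) - F x - D h) / norm h \<le> K * norm h"
    proof (intro always_eventually allI)
      fix h
      \<comment> \<open>The bound is shown for every \<open>h\<close>; at \<open>h = 0\<close> both
        sides are 0 because division by zero yields 0.\<close>
      show "norm (F (x + h) - F x - D h) / norm h \<le> K * norm h"
        using est[of h] by (cases "h = 0") (auto simp: divide_le_eq power2_eq_square mult_ac)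
    qed
    show "((\<lambda>h. K * norm h) \<longlongrightarrow> 0) (at (0::real^'d))"
      by (auto intro!: tendsto_eq_intros)
  qed
  then have "(F has_derivative D) (at x)"
    unfolding has_derivative_at using bl by blast
  then show ?thesis unfolding F_def D_def .
qed

section \<open>Convolution of Schwartz functions\<close>

lemma weight_submult:
  fixes x y :: "'a::real_normed_vector"
  shows "(1 + norm x) ^ k \<le> (1 + norm y) ^ k * (1 + norm (x - y)) ^ k"
proof -
  have "norm x \<le> norm y + norm (x - y)" using norm_triangle_ineq[of y "x - y"] by simp
  moreover have "0 \<le> norm y * norm (x - y)" by simp
  moreover have "(1 + norm y) * (1 + norm (x - y)) = 1 + norm y + norm (x - y) + norm y * norm (x - y)"
    by (simp add: algebra_simps)
  ultimately have "1 + norm x \<le> (1 + norm y) * (1 + norm (x - y))" by linarith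
  then show ?thesis unfolding power_mult_distrib[symmetric] by (intro power_mono) auto
qed

lemma schwartz_bounded:
  assumes "f \<in> schwartz_space"
  obtains C where "C \<ge> 0" "\<And>x. norm (iterated_partial is f x) \<le> C"
  using schwartz_decay[OF assms, of 0 "is"] by auto

lemma convolve_integrable:
  fixes h \<psi> :: "real^'d::finite \<Rightarrow> complex"
  assumes h: "h \<in> schwartz_space" and \<psi>: "\<psi> \<in> schwartz_space"
  shows "integrable lborel (\<lambda>y. h y * \<psi> (x - y))"
proof -
  obtain B where B: "B \<ge> 0" "\<And>z. norm (iterated_partial [] \<psi> z) \<le> B"
    by (rule schwartz_bounded[OF \<psi>]) blast
  have [measurable]: "h \<in> borel_measurable borel" "\<psi> \<in> borel_measurable borel"
    by (auto intro: schwartz_measurable assms)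
  show ?thesis
  proof (rule Bochner_Integration.integrable_bound[OF integrable_mult_right[OF schwartz_integrable[OF h], of B]])
    show "AE y in lborel. norm (h y * \<psi> (x - y)) \<le> norm (complex_of_real B * h y)"
      using B(1) mult_left_mono[OF B(2)[of "x - _"] norm_ge_zero[of "h _"]]
      by (intro AE_I2) (simp add: norm_mult mult.commute[of B])
  qed measurable
qed

text \<open>Submultiplicativity splits the weight at \<open>x\<close> into one at \<open>y\<close>,
  absorbed by the moment of \<open>h\<close>, and one at \<open>x - y\<close>, absorbed by
  \<open>B\<close>. The result is linear in \<open>B\<close>, so rates of decay in a parameter carry
  over.\<close>

lemma convolve_weight_bound:
  fixes h \<psi> :: "real^'d::finite \<Rightarrow> complex"
  assumes h: "h \<in> schwartz_space" and \<psi>: "\<psi> \<in> schwartz_space"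
    and B: "\<And>z. (1 + norm z) ^ k * norm (\<psi> z) \<le> B"
  shows "(1 + norm x) ^ k * norm (convolve h \<psi> x) \<le> (LINT y|lborel. (1 + norm y) ^ k * norm (h y)) * B"
proof -
  have "(1 + norm x) ^ k * norm (convolve h \<psi> x)
      \<le> (1 + norm x) ^ k * (LINT y|lborel. norm (h y * \<psi> (x - y)))"
    unfolding convolve_def by (intro mult_left_mono integral_norm_bound) auto
  also have "\<dots> = (LINT y|lborel. (1 + norm x) ^ k * norm (h y * \<psi> (x - y)))" by simp
  also have "\<dots> \<le> (LINT y|lborel. (1 + norm y) ^ k * norm (h y) * B)"
  proof (intro integral_mono integrable_mult_right integrable_norm convolve_integrable h \<psi>
      integrable_mult_left schwartz_integrable_weighted)
    fix y
    have "(1 + norm x) ^ k * norm (h y * \<psi> (x - y))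
      \<le> (1 + norm y) ^ k * (1 + norm (x - y)) ^ k * norm (h y * \<psi> (x - y))"
      by (intro mult_right_mono weight_submult) auto
    also have "\<dots> = (1 + norm y) ^ k * norm (h y) * ((1 + norm (x - y)) ^ k * norm (\<psi> (x - y)))"
      by (simp add: norm_mult mult_ac)
    also have "\<dots> \<le> (1 + norm y) ^ k * norm (h y) * B"
      by (intro mult_left_mono B) auto
    finally show "(1 + norm x) ^ k * norm (h y * \<psi> (x - y)) \<le> (1 + norm y) ^ k * norm (h y) * B" .
  qed
  finally show ?thesis by simp
qed

text \<open>All derivatives are moved onto the second factor by differentiating under the integral.
  The majorant is \<open>norm (h y)\<close> times the uniform Taylor constant of the differentiated
  \<psi>.\<close>

lemma
  fixes h \<psi> :: "real^'d::finite \<Rightarrow> complex"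
  assumes h: "h \<in> schwartz_space" and \<psi>: "\<psi> \<in> schwartz_space"
  shows iterated_partial_convolve:
      "iterated_partial is (convolve h \<psi>) = convolve h (iterated_partial is \<psi>)" (is ?A)
    and smooth_convolve: "smooth (convolve h \<psi>)" (is ?B)
proof -
  define F where "F is = convolve h (iterated_partial is \<psi>)" for "is"
  define D where "D is x = (\<lambda>v. \<Sum>i\<in>UNIV. v $ i *\<^sub>R
      (LINT y|lborel. h y * iterated_partial (i # is) \<psi> (x - y)))" for "is" and x :: "real^'d"
  have F: "F [] = convolve h \<psi>" by (simp add: F_def)
  have 1: "(F is has_derivative D is x) (at x)" for "is" x
  proof -
    have "\<exists>C\<ge>0. \<forall>z. norm (iterated_partial [i, j] (iterated_partial is \<psi>) z) \<le> C" for i j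
      by (rule schwartz_bounded[OF schwartz_iterated_partial[OF \<psi>]]) blast
    then obtain C where C: "\<And>i j. 0 \<le> C i j"
      "\<And>i j z. norm (iterated_partial [i, j] (iterated_partial is \<psi>) z) \<le> C i j"
      by metis
    \<comment> \<open>Summing the nonnegative constants over the finitely many index pairs gives one
      bound for all second partials.\<close>
    define B where "B = (\<Sum>i\<in>UNIV. \<Sum>j\<in>UNIV. C i j)"
    have B: "norm (iterated_partial [i, j] (iterated_partial is \<psi>) z) \<le> B" for i j z
    proof -
      have "C i j \<le> (\<Sum>j\<in>UNIV. C i j)" by (rule member_le_sum) (auto simp: C)
      also have "\<dots> \<le> B" unfolding B_def
        by (rule member_le_sum[of i]) (auto intro: sum_nonneg C)
      finally show ?thesis using C(2) order_trans by blast
    qed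
    note rem = smooth_quadratic_remainder[OF schwartz_smooth[OF schwartz_iterated_partial[OF \<psi>]] B]
    show ?thesis
      unfolding F_def D_def convolve_def
    proof (rule has_derivative_integral_quadratic[where
          G = "\<lambda>y. norm (h y) * ((real CARD('d))\<^sup>2 * B)"])
      show "integrable lborel (\<lambda>y. norm (h y) * ((real CARD('d))\<^sup>2 * B))"
        by (intro integrable_mult_left integrable_norm schwartz_integrable h)
      fix v y
      let ?p = "iterated_partial is \<psi>"
      have "h y * ?p (x + v - y) - h y * ?p (x - y) -
           (\<Sum>i\<in>UNIV. v $ i *\<^sub>R (h y * iterated_partial (i # is) \<psi> (x - y)))
        = h y * (?p ((x - y) + v) - ?p (x - y) - (\<Sum>i\<in>UNIV. v $ i *\<^sub>R iterated_partial [i] ?p (x - y)))"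
        by (simp add: algebra_simps sum_distrib_left scaleR_conv_of_real)
      also have "norm \<dots> \<le> norm (h y) * ((real CARD('d))\<^sup>2 * B * (norm v)\<^sup>2)"
        unfolding norm_mult by (intro mult_left_mono rem) auto
      finally show "norm (h y * ?p (x + v - y) - h y * ?p (x - y) -
           (\<Sum>i\<in>UNIV. v $ i *\<^sub>R (h y * iterated_partial (i # is) \<psi> (x - y))))
         \<le> norm (h y) * ((real CARD('d))\<^sup>2 * B) * (norm v)\<^sup>2" by (simp add: mult_ac)
    qed (intro convolve_integrable h schwartz_iterated_partial \<psi>)+
  qed
  have 2: "D is x (axis i 1) = F (i # is) x" for i "is" x
    unfolding F_def D_def axis_sum_scaleR convolve_def ..
  show ?A using iterated_partial_eqI[of F _ D, OF F 1 2] by (simp add: F_def)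
  show ?B by (rule smoothI[of F _ D, OF F 1 2])
qed

lemma schwartz_convolve:
  assumes h: "h \<in> schwartz_space" and \<psi>: "\<psi> \<in> schwartz_space"
  shows "convolve h \<psi> \<in> schwartz_space"
proof (rule schwartzI[OF smooth_convolve[OF assms]])
  fix k "is"
  obtain C where C: "\<And>x. (1 + norm x) ^ k * norm (iterated_partial is \<psi> x) \<le> C"
    by (rule schwartz_decay[OF \<psi>]) blast
  show "\<exists>C. \<forall>x. (1 + norm x) ^ k * norm (iterated_partial is (convolve h \<psi>) x) \<le> C"
    unfolding iterated_partial_convolve[OF assms]
    using convolve_weight_bound[OF h schwartz_iterated_partial[OF \<psi>] C] by blast
qed

lemma convolve_linear:
  assumes h: "h \<in> schwartz_space" and "\<phi> \<in> schwartz_space" "\<psi> \<in> schwartz_space"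
  shows "convolve h (\<lambda>x. a * \<phi> x + b * \<psi> x) = (\<lambda>x. a * convolve h \<phi> x + b * convolve h \<psi> x)"
proof
  fix x
  have "convolve h (\<lambda>x. a * \<phi> x + b * \<psi> x) x =
     (LINT y|lborel. a * (h y * \<phi> (x - y)) + b * (h y * \<psi> (x - y)))"
    unfolding convolve_def by (simp add: algebra_simps)
  also have "\<dots> = a * convolve h \<phi> x + b * convolve h \<psi> x"
    unfolding convolve_def using convolve_integrable[OF h assms(2)] convolve_integrable[OF h assms(3)]
    by simp
  finally show "convolve h (\<lambda>x. a * \<phi> x + b * \<psi> x) x = a * convolve h \<phi> x + b * convolve h \<psi> x" .
qed

section \<open>Continuity along null sequences\<close>

text \<open>
  Continuity is tested only on sequences that tend to zero at the fixed rate \<open>1 / (n + 1)\<close>,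
  which suffices here and is stable under convolution without any appeal to the topology.
\<close>

definition schwartz_null :: "(nat \<Rightarrow> real^'d::finite \<Rightarrow> complex) \<Rightarrow> bool" where
  "schwartz_null \<psi> \<longleftrightarrow> (\<forall>n. \<psi> n \<in> schwartz_space) \<and>
     (\<forall>k is. \<exists>C. \<forall>n x. (1 + norm x) ^ k * norm (iterated_partial is (\<psi> n) x) \<le> C / real (Suc n))"

definition null_continuous :: "'d::finite functional \<Rightarrow> bool" where
  "null_continuous T \<longleftrightarrow>
     (\<forall>\<phi>\<in>schwartz_space. \<forall>\<psi>\<in>schwartz_space. \<forall>a b.
        T (\<lambda>x. a * \<phi> x + b * \<psi> x) = a * T \<phi> + b * T \<psi>) \<and>
     (\<forall>\<psi>. schwartz_null \<psi> \<longrightarrow> (\<lambda>n. T (\<psi> n)) \<longlonglongrightarrow> 0)"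

lemma schwartz_nullI:
  assumes "\<And>n. \<psi> n \<in> schwartz_space"
    and "\<And>k is. \<exists>C. \<forall>n x. (1 + norm x) ^ k * norm (iterated_partial is (\<psi> n) x) \<le> C / real (Suc n)"
  shows "schwartz_null \<psi>"
  using assms unfolding schwartz_null_def by blast

lemma schwartz_nullD:
  assumes "schwartz_null \<psi>"
  shows "\<psi> n \<in> schwartz_space"
    and "\<exists>C. \<forall>n x. (1 + norm x) ^ k * norm (iterated_partial is (\<psi> n) x) \<le> C / real (Suc n)"
  using assms unfolding schwartz_null_def by blast+

lemma null_continuousI:
  assumes "\<And>\<phi> \<psi> a b. \<phi> \<in> schwartz_space \<Longrightarrow> \<psi> \<in> schwartz_space \<Longrightarrow>
      T (\<lambda>x. a * \<phi> x + b * \<psi> x) = a * T \<phi> + b * T \<psi>"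
    and "\<And>\<psi>. schwartz_null \<psi> \<Longrightarrow> (\<lambda>n. T (\<psi> n)) \<longlonglongrightarrow> 0"
  shows "null_continuous T"
  using assms unfolding null_continuous_def by blast

lemma null_continuous_linear:
  assumes "null_continuous T" "\<phi> \<in> schwartz_space" "\<psi> \<in> schwartz_space"
  shows "T (\<lambda>x. a * \<phi> x + b * \<psi> x) = a * T \<phi> + b * T \<psi>"
  using assms unfolding null_continuous_def by blast

lemma null_continuous_tendsto:
  "null_continuous T \<Longrightarrow> schwartz_null \<psi> \<Longrightarrow> (\<lambda>n. T (\<psi> n)) \<longlonglongrightarrow> 0"
  unfolding null_continuous_def by blast

section \<open>Operations preserving null sequences and null continuity\<close>

lemma schwartz_null_conj_fun:
  assumes "schwartz_null \<psi>"
  shows "schwartz_null (\<lambda>n. conj_fun (\<psi> n))"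
proof (rule schwartz_nullI)
  note S = schwartz_nullD(1)[OF assms]
  show "conj_fun (\<psi> n) \<in> schwartz_space" for n by (rule schwartz_conj_fun[OF S])
  show "\<exists>C. \<forall>n x. (1 + norm x) ^ k * norm (iterated_partial is (conj_fun (\<psi> n)) x) \<le> C / real (Suc n)" for k "is"
    using schwartz_nullD(2)[OF assms, of k "is"]
    unfolding iterated_partial_conj_fun[OF schwartz_smooth[OF S]] by (simp add: conj_fun_def)
qed

lemma schwartz_null_reflect:
  assumes "schwartz_null \<psi>"
  shows "schwartz_null (\<lambda>n. reflect (\<psi> n))"
proof (rule schwartz_nullI)
  note S = schwartz_nullD(1)[OF assms]
  show "reflect (\<psi> n) \<in> schwartz_space" for n by (rule schwartz_reflect[OF S])
  fix k "is"
  obtain C where C: "\<And>n x. (1 + norm x) ^ k * norm (iterated_partial is (\<psi> n) x) \<le> C / real (Suc n)"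
    using schwartz_nullD(2)[OF assms] by blast
  show "\<exists>C. \<forall>n x. (1 + norm x) ^ k * norm (iterated_partial is (reflect (\<psi> n)) x) \<le> C / real (Suc n)"
    unfolding iterated_partial_reflect[OF schwartz_smooth[OF S]]
    using C[of "- _"] by (intro exI[of _ C]) (simp add: power_abs)
qed

lemma schwartz_null_convolve:
  assumes h: "h \<in> schwartz_space" and "schwartz_null \<psi>"
  shows "schwartz_null (\<lambda>n. convolve h (\<psi> n))"
proof (rule schwartz_nullI)
  note S = schwartz_nullD(1)[OF assms(2)]
  show "convolve h (\<psi> n) \<in> schwartz_space" for n by (rule schwartz_convolve[OF h S])
  fix k "is"
  obtain C where C: "\<And>n x. (1 + norm x) ^ k * norm (iterated_partial is (\<psi> n) x) \<le> C / real (Suc n)"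
    using schwartz_nullD(2)[OF assms(2)] by blast
  show "\<exists>C. \<forall>n x. (1 + norm x) ^ k * norm (iterated_partial is (convolve h (\<psi> n)) x) \<le> C / real (Suc n)"
    unfolding iterated_partial_convolve[OF h S]
    using convolve_weight_bound[OF h schwartz_iterated_partial[OF S] C]
    by (intro exI[of _ "(LINT y|lborel. (1 + norm y) ^ k * norm (h y)) * C"]) simp
qed

lemma null_continuous_dist_conj:
  assumes "null_continuous T"
  shows "null_continuous (dist_conj T)"
proof (rule null_continuousI)
  fix \<phi> \<psi> :: "real^'a \<Rightarrow> complex" and a b
  assume *: "\<phi> \<in> schwartz_space" "\<psi> \<in> schwartz_space"
  \<comment> \<open>The inner conjugation makes the scalars \<open>cnj a\<close> and
    \<open>cnj b\<close>; the outer one in \<open>dist_conj\<close> restores them, so linearity is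
    not turned into antilinearity.\<close>
  have "conj_fun (\<lambda>x. a * \<phi> x + b * \<psi> x) = (\<lambda>x. cnj a * conj_fun \<phi> x + cnj b * conj_fun \<psi> x)"
    by (simp add: conj_fun_def)
  then show "dist_conj T (\<lambda>x. a * \<phi> x + b * \<psi> x) = a * dist_conj T \<phi> + b * dist_conj T \<psi>"
    unfolding dist_conj_def
    using null_continuous_linear[OF assms schwartz_conj_fun[OF *(1)] schwartz_conj_fun[OF *(2)]]
    by simp
next
  fix \<psi> :: "nat \<Rightarrow> real^'a \<Rightarrow> complex"
  assume "schwartz_null \<psi>"
  from tendsto_cnj[OF null_continuous_tendsto[OF assms schwartz_null_conj_fun[OF this]]]
  show "(\<lambda>n. dist_conj T (\<psi> n)) \<longlonglongrightarrow> 0" by (simp add: dist_conj_def)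
qed

lemma null_continuous_dist_reflect:
  assumes "null_continuous T"
  shows "null_continuous (dist_reflect T)"
proof (rule null_continuousI)
  fix \<phi> \<psi> :: "real^'a \<Rightarrow> complex" and a b
  assume *: "\<phi> \<in> schwartz_space" "\<psi> \<in> schwartz_space"
  have "reflect (\<lambda>x. a * \<phi> x + b * \<psi> x) = (\<lambda>x. a * reflect \<phi> x + b * reflect \<psi> x)"
    by (simp add: reflect_def)
  then show "dist_reflect T (\<lambda>x. a * \<phi> x + b * \<psi> x) = a * dist_reflect T \<phi> + b * dist_reflect T \<psi>"
    unfolding dist_reflect_def
    using null_continuous_linear[OF assms schwartz_reflect[OF *(1)] schwartz_reflect[OF *(2)]]
    by simp
next
  fix \<psi> :: "nat \<Rightarrow> real^'a \<Rightarrow> complex"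
  assume "schwartz_null \<psi>"
  from null_continuous_tendsto[OF assms schwartz_null_reflect[OF this]]
  show "(\<lambda>n. dist_reflect T (\<psi> n)) \<longlonglongrightarrow> 0" by (simp add: dist_reflect_def)
qed

lemma null_continuous_convolve_fun_dist:
  assumes "null_continuous T" and f: "f \<in> schwartz_space"
  shows "null_continuous (convolve_fun_dist f T)"
proof (rule null_continuousI)
  note rf = schwartz_reflect[OF f]
  fix \<phi> \<psi> :: "real^'a \<Rightarrow> complex" and a b
  assume *: "\<phi> \<in> schwartz_space" "\<psi> \<in> schwartz_space"
  show "convolve_fun_dist f T (\<lambda>x. a * \<phi> x + b * \<psi> x) =
      a * convolve_fun_dist f T \<phi> + b * convolve_fun_dist f T \<psi>"
    unfolding convolve_fun_dist_def convolve_linear[OF rf *]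
    by (rule null_continuous_linear[OF assms(1) schwartz_convolve[OF rf *(1)] schwartz_convolve[OF rf *(2)]])
next
  fix \<psi> :: "nat \<Rightarrow> real^'a \<Rightarrow> complex"
  assume "schwartz_null \<psi>"
  from null_continuous_tendsto[OF assms(1) schwartz_null_convolve[OF schwartz_reflect[OF f] this]]
  show "(\<lambda>n. convolve_fun_dist f T (\<psi> n)) \<longlonglongrightarrow> 0" by (simp add: convolve_fun_dist_def)
qed

lemma const_div_Suc_tendsto_0: "(\<lambda>n. C / real (Suc n)) \<longlonglongrightarrow> 0"
  using tendsto_mult_right_zero[OF LIMSEQ_inverse_real_of_nat, of C] by (simp add: divide_inverse)

text \<open>A weight with integrable reciprocal turns a single weighted sup bound into an L1 bound
  with the same rate \<open>1 / (n + 1)\<close>.\<close>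

lemma null_continuous_one: "null_continuous (dist_of_fun (\<lambda>_. 1))"
proof (rule null_continuousI)
  fix \<phi> \<psi> :: "real^'a \<Rightarrow> complex" and a b
  assume "\<phi> \<in> schwartz_space" "\<psi> \<in> schwartz_space"
  then show "dist_of_fun (\<lambda>_. 1) (\<lambda>x. a * \<phi> x + b * \<psi> x) =
      a * dist_of_fun (\<lambda>_. 1) \<phi> + b * dist_of_fun (\<lambda>_. 1) \<psi>"
    by (simp add: dist_of_fun_def schwartz_integrable)
next
  fix \<psi> :: "nat \<Rightarrow> real^'a \<Rightarrow> complex"
  assume \<psi>: "schwartz_null \<psi>"
  obtain l where l: "integrable lborel (\<lambda>x::real^'a. 1 / (1 + norm x) ^ l)"
    using weight_integrable by blast
  obtain C where C: "\<And>n x. (1 + norm x) ^ l * norm (iterated_partial [] (\<psi> n) x) \<le> C / real (Suc n)"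
    using schwartz_nullD(2)[OF \<psi>] by blast
  have "norm (dist_of_fun (\<lambda>_. 1) (\<psi> n)) \<le> (LINT x|lborel. 1 / (1 + norm (x::real^'a)) ^ l) * C / real (Suc n)" for n
  proof -
    have "norm (dist_of_fun (\<lambda>_. 1) (\<psi> n)) \<le> (LINT x|lborel. norm (\<psi> n x))"
      unfolding dist_of_fun_def using integral_norm_bound[of lborel "\<psi> n"] by simp
    also have "\<dots> \<le> (LINT x|lborel. 1 / (1 + norm (x::real^'a)) ^ l * (C / real (Suc n)))"
    proof (intro integral_mono integrable_norm integrable_mult_left l schwartz_integrable schwartz_nullD(1)[OF \<psi>])
      fix x :: "real^'a"
      have "0 < (1 + norm x) ^ l" by (simp add: add_pos_nonneg)
      then show "norm (\<psi> n x) \<le> 1 / (1 + norm x) ^ l * (C / real (Suc n))"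
        using C[of x n] by (simp add: pos_le_divide_eq mult_ac del: of_nat_Suc)
    qed
    also have "\<dots> = (LINT x|lborel. 1 / (1 + norm (x::real^'a)) ^ l) * (C / real (Suc n))"
      by (simp only: integral_mult_left_zero)
    finally show ?thesis by (simp only: times_divide_eq_right)
  qed
  then show "(\<lambda>n. dist_of_fun (\<lambda>_. 1) (\<psi> n)) \<longlonglongrightarrow> 0"
    by (intro Lim_null_comparison[OF _ const_div_Suc_tendsto_0] always_eventually) blast
qed

section \<open>From the generated topology to null sequences\<close>

lemma schwartz_seminorm_upper:
  assumes "f \<in> schwartz_space"
  shows "norm (monomial \<alpha> x *\<^sub>R iterated_partial is f x) \<le> schwartz_seminorm \<alpha> is f"
proof -
  have "bounded (range (\<lambda>x. monomial \<alpha> x *\<^sub>R iterated_partial is f x))"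
    using assms by (simp add: schwartz_space_def)
  then have "bdd_above (range (\<lambda>x. norm (monomial \<alpha> x *\<^sub>R iterated_partial is f x)))"
    unfolding bounded_iff bdd_above_def by auto
  then show ?thesis unfolding schwartz_seminorm_def by (rule cSUP_upper2) auto
qed

text \<open>The term \<open>0 - g x\<close> is kept in this form because it is what membership of
  the zero function in a basic open set centred at \<open>g\<close> provides.\<close>

lemma schwartz_seminorm_triangle:
  assumes f: "f \<in> schwartz_space" and g: "g \<in> schwartz_space"
  shows "schwartz_seminorm \<alpha> is (\<lambda>x. f x - g x) \<le>
    schwartz_seminorm \<alpha> is f + schwartz_seminorm \<alpha> is (\<lambda>x. 0 - g x)"
  unfolding schwartz_seminorm_def[of \<alpha> "is" "\<lambda>x. f x - g x"]
proof (rule cSUP_least)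
  fix x
  note lin = iterated_partial_linear[OF schwartz_smooth schwartz_smooth]
  have 1: "iterated_partial is (\<lambda>x. f x - g x) = (\<lambda>x. iterated_partial is f x - iterated_partial is g x)"
    using lin[OF f g, of "is" 1 "-1"] by simp
  have 2: "iterated_partial is (\<lambda>x. 0 - g x) = (\<lambda>x. - iterated_partial is g x)"
    using lin[OF f g, of "is" 0 "-1"] by simp
  have "norm (monomial \<alpha> x *\<^sub>R iterated_partial is (\<lambda>x. f x - g x) x) \<le>
     norm (monomial \<alpha> x *\<^sub>R iterated_partial is f x) +
     norm (monomial \<alpha> x *\<^sub>R iterated_partial is (\<lambda>x. 0 - g x) x)"
    unfolding 1 2 scaleR_right_diff_distrib scaleR_minus_right norm_minus_cancel
    by (rule norm_triangle_ineq4)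
  also have "\<dots> \<le> schwartz_seminorm \<alpha> is f + schwartz_seminorm \<alpha> is (\<lambda>x. 0 - g x)"
    by (intro add_mono schwartz_seminorm_upper f schwartz_diff schwartz_zero g)
  finally show "norm (monomial \<alpha> x *\<^sub>R iterated_partial is (\<lambda>x. f x - g x) x) \<le>
     schwartz_seminorm \<alpha> is f + schwartz_seminorm \<alpha> is (\<lambda>x. 0 - g x)" .
qed simp

lemma schwartz_null_seminorm:
  assumes "schwartz_null \<psi>"
  shows "\<exists>C. \<forall>n. schwartz_seminorm \<alpha> is (\<psi> n) \<le> C / real (Suc n)"
proof -
  obtain C where C: "\<And>n x. (1 + norm x) ^ (\<Sum>i\<in>UNIV. \<alpha> i) * norm (iterated_partial is (\<psi> n) x)
      \<le> C / real (Suc n)"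
    using schwartz_nullD(2)[OF assms] by blast
  have "schwartz_seminorm \<alpha> is (\<psi> n) \<le> C / real (Suc n)" for n
    unfolding schwartz_seminorm_def
  proof (rule cSUP_least)
    fix x
    show "norm (monomial \<alpha> x *\<^sub>R iterated_partial is (\<psi> n) x) \<le> C / real (Suc n)"
      unfolding norm_scaleR real_norm_def
      by (rule order_trans[OF mult_right_mono[OF norm_monomial_le norm_ge_zero] C])
  qed simp
  then show ?thesis by blast
qed

text \<open>Induction on the generation of the open set reduces the claim to the generating balls,
  whose centre \<open>g\<close> need not be 0.\<close>

lemma eventually_schwartz_null_in:
  assumes "openin schwartz_topology U" and "(\<lambda>x. 0) \<in> U" and \<psi>: "schwartz_null \<psi>"
  shows "\<forall>\<^sub>F n in sequentially. \<psi> n \<in> U"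
proof -
  have "generate_topology_on {{f \<in> schwartz_space. schwartz_seminorm \<alpha> is (\<lambda>x. f x - g x) < r} | \<alpha> is g r.
        g \<in> schwartz_space \<and> 0 < r} U"
    using assms(1) unfolding schwartz_topology_def openin_topology_generated_by_iff .
  then show ?thesis using assms(2)
  proof induction
    case Empty
    then show ?case by simp
  next
    case (Int a b)
    then have "\<forall>\<^sub>F n in sequentially. \<psi> n \<in> a" "\<forall>\<^sub>F n in sequentially. \<psi> n \<in> b"
      by blast+
    then show ?case by eventually_elim simp
  next
    case (UN K)
    then obtain k where "k \<in> K" "(\<lambda>x. 0) \<in> k" by blast
    with UN.IH have "\<forall>\<^sub>F n in sequentially. \<psi> n \<in> k" by blast
    then show ?case by eventually_elim (use \<open>k \<in> K\<close> in blast)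
  next
    case (Basis s)
    then obtain \<alpha> "is" g r where s: "s = {f \<in> schwartz_space. schwartz_seminorm \<alpha> is (\<lambda>x. f x - g x) < r}"
      and g: "g \<in> schwartz_space" by blast
    \<comment> \<open>The slack left by the zero function inside the ball around \<open>g\<close>.
      By the triangle inequality, any member of the sequence with seminorm below \<open>e\<close>
      stays in that ball.\<close>
    define e where "e = r - schwartz_seminorm \<alpha> is (\<lambda>x. 0 - g x)"
    have "e > 0" using Basis.prems by (simp add: s e_def)
    obtain C where C: "\<And>n. schwartz_seminorm \<alpha> is (\<psi> n) \<le> C / real (Suc n)"
      using schwartz_null_seminorm[OF \<psi>] by blast
    have "\<forall>\<^sub>F n in sequentially. C / real (Suc n) < e"
      by (rule order_tendstoD(2)[OF const_div_Suc_tendsto_0 \<open>e > 0\<close>])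
    then show ?case
    proof eventually_elim
      case (elim n)
      then show ?case
        using schwartz_seminorm_triangle[OF schwartz_nullD(1)[OF \<psi>, of n] g, of \<alpha> "is"] C[of n]
          schwartz_nullD(1)[OF \<psi>, of n]
        by (simp add: s e_def)
    qed
  qed
qed

lemma topspace_schwartz_topology: "topspace schwartz_topology = schwartz_space"
proof -
  have "f \<in> topspace schwartz_topology" if f: "f \<in> schwartz_space" for f :: "real^'a \<Rightarrow> complex"
  proof -
    \<comment> \<open>Each Schwartz function lies in the unit ball around itself for the sup norm,
      so the generating sets cover the whole space.\<close>
    define s where "s = {h \<in> schwartz_space. schwartz_seminorm (\<lambda>_. 0) [] (\<lambda>x. h x - f x) < 1}"
    have "schwartz_seminorm (\<lambda>_. 0) [] (\<lambda>x. f x - f x) = 0"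
      by (simp add: schwartz_seminorm_def)
    then have "f \<in> s" using f by (simp add: s_def)
    moreover have "s \<in> {{f \<in> schwartz_space. schwartz_seminorm \<alpha> is (\<lambda>x. f x - g x) < r} | \<alpha> is g r.
        g \<in> schwartz_space \<and> 0 < r}"
      unfolding s_def using f zero_less_one by blast
    ultimately show ?thesis
      unfolding schwartz_topology_def topology_generated_by_topspace by blast
  qed
  then show ?thesis
    unfolding schwartz_topology_def topology_generated_by_topspace by blast
qed

text \<open>Linearity sends the zero function to 0, so the preimage of a neighbourhood of 0 is an
  open set containing the zero function and eventually absorbs every null sequence.\<close>

lemma tempered_null_continuous:
  fixes T :: "'d::finite functional"
  assumes "T \<in> tempered_distributions"
  shows "null_continuous T"
proof -
  have lin: "\<forall>\<phi>\<in>schwartz_space. \<forall>\<psi>\<in>schwartz_space. \<forall>a b.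
      T (\<lambda>x. a * \<phi> x + b * \<psi> x) = a * T \<phi> + b * T \<psi>"
    and cont: "continuous_map schwartz_topology euclidean T"
    using assms unfolding tempered_distributions_def by simp_all
  have "T (\<lambda>x. 0 * 0 + 0 * 0) = 0 * T (\<lambda>x. 0) + 0 * T (\<lambda>x. 0)"
    using lin[rule_format, OF schwartz_zero schwartz_zero] .
  then have T0: "T (\<lambda>x. 0) = 0" by simp
  have "(\<lambda>n. T (\<psi> n)) \<longlonglongrightarrow> 0" if \<psi>: "schwartz_null \<psi>" for \<psi>
  proof (rule topological_tendstoI)
    fix V :: "complex set"
    assume V: "open V" "0 \<in> V"
    have "openin schwartz_topology {f \<in> topspace schwartz_topology. T f \<in> V}"
      by (rule openin_continuous_map_preimage[OF cont]) (simp add: V)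
    then have "\<forall>\<^sub>F n in sequentially. \<psi> n \<in> {f \<in> topspace schwartz_topology. T f \<in> V}"
      by (rule eventually_schwartz_null_in[OF _ _ \<psi>])
        (simp add: topspace_schwartz_topology schwartz_zero T0 V)
    then show "\<forall>\<^sub>F n in sequentially. T (\<psi> n) \<in> V" by eventually_elim simp
  qed
  with lin show ?thesis unfolding null_continuous_def by blast
qed

section \<open>The Fourier transform as a multiplier\<close>

text \<open>Isolates the decay that differentiating a Fourier transform consumes. The class is
  closed under multiplication by coordinates, which is what each differentiation produces under the
  integral.\<close>

definition all_moments :: "(real^'d::finite \<Rightarrow> complex) \<Rightarrow> bool" where
  "all_moments m \<longleftrightarrow> m \<in> borel_measurable borel \<and>
     (\<forall>k. integrable lborel (\<lambda>t. (1 + norm t) ^ k * norm (m t)))"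

lemma schwartz_all_moments: "m \<in> schwartz_space \<Longrightarrow> all_moments m"
  by (simp add: all_moments_def schwartz_measurable schwartz_integrable_weighted)

lemma all_moments_integrable:
  assumes "all_moments m"
  shows "integrable lborel (\<lambda>t. norm (m t))"
proof -
  have "integrable lborel (\<lambda>t. (1 + norm t) ^ 0 * norm (m t))"
    using assms unfolding all_moments_def by blast
  then show ?thesis by simp
qed

lemma all_moments_mult_component:
  assumes "all_moments m"
  shows "all_moments (\<lambda>t. c * of_real (t $ i) * m t)"
  unfolding all_moments_def
proof (intro conjI allI)
  have [measurable]: "m \<in> borel_measurable borel" using assms by (simp add: all_moments_def)
  show meas[measurable]: "(\<lambda>t. c * of_real (t $ i) * m t) \<in> borel_measurable borel" by measurable
  fix k
  have int: "integrable lborel (\<lambda>t. norm c * ((1 + norm t) ^ Suc k * norm (m t)))"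
    using assms unfolding all_moments_def by (intro integrable_mult_right) blast
  show "integrable lborel (\<lambda>t. (1 + norm t) ^ k * norm (c * of_real (t $ i) * m t))"
  proof (rule Bochner_Integration.integrable_bound[OF int], measurable, intro AE_I2)
    fix t
    have "(1 + norm t) ^ k * (norm c * \<bar>t $ i\<bar> * norm (m t))
      \<le> (1 + norm t) ^ k * (norm c * (1 + norm t) * norm (m t))"
      by (intro mult_left_mono mult_right_mono) (auto intro: order_trans[OF component_le_norm_cart])
    then show "norm ((1 + norm t) ^ k * norm (c * of_real (t $ i) * m t))
      \<le> norm (norm c * ((1 + norm t) ^ Suc k * norm (m t)))"
      by (simp add: norm_mult abs_mult mult_ac)
  qed
qed

text \<open>Linearisation at 0: the derivative of \<open>exp (\<i> * s)\<close> moves by the chord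
  length \<open>2 * \<bar>sin (s / 2)\<bar>\<close>, which is at most
  \<open>\<bar>s\<bar>\<close>.\<close>

lemma norm_exp_i_remainder:
  "norm (exp (\<i> * of_real \<theta>) - 1 - \<i> * of_real \<theta>) \<le> \<theta>\<^sup>2"
proof -
  have "norm (exp (\<i> * of_real \<theta>) - exp (\<i> * of_real 0) -
      of_real (\<theta> - 0) * (\<i> * exp (\<i> * of_real 0))) \<le> norm (\<theta> - 0) * \<bar>\<theta>\<bar>"
  proof (rule differentiable_bound_linearization[where S = "cball 0 \<bar>\<theta>\<bar>"])
    show "0 + t *\<^sub>R (\<theta> - 0) \<in> cball 0 \<bar>\<theta>\<bar>" if "t \<in> {0..1}" for t
      using that by (auto simp: abs_mult intro: mult_left_le_one_le)
    show "((\<lambda>s. exp (\<i> * of_real s)) has_derivative (\<lambda>h. of_real h * (\<i> * exp (\<i> * of_real s))))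
       (at s within cball 0 \<bar>\<theta>\<bar>)" for s :: real
    proof -
      have 1: "((\<lambda>s. \<i> * of_real s) has_derivative (\<lambda>h. \<i> * of_real h)) (at s within cball 0 \<bar>\<theta>\<bar>)"
        by (intro has_derivative_mult_right has_derivative_of_real has_derivative_ident)
      have "(exp has_derivative (*) (exp (\<i> * of_real s))) (at (\<i> * of_real s :: complex))"
        using DERIV_exp unfolding has_field_derivative_def .
      from has_derivative_compose[OF 1 this] show ?thesis by (simp add: mult_ac)
    qed
    fix s :: real assume s: "s \<in> cball 0 \<bar>\<theta>\<bar>"
    have "\<bar>sin (s / 2)\<bar> \<le> \<bar>s / 2\<bar>" by (rule abs_sin_x_le_abs_x)
    then have le: "norm (exp (\<i> * of_real s) - 1) \<le> \<bar>\<theta>\<bar>"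
      using s by (simp add: dist_exp_i_1)
    have "norm ((of_real h * (\<i> * exp (\<i> * of_real s)) - of_real h * (\<i> * exp (\<i> * of_real 0)) :: complex))
      \<le> \<bar>\<theta>\<bar> * norm h" for h :: real
      using mult_right_mono[OF le abs_ge_zero[of h]]
      unfolding right_diff_distrib[symmetric] norm_mult by (simp add: mult.commute)
    then show "onorm ((\<lambda>h. of_real h * (\<i> * exp (\<i> * of_real s))) -
        (\<lambda>h. of_real h * (\<i> * exp (\<i> * of_real 0))) :: real \<Rightarrow> complex) \<le> \<bar>\<theta>\<bar>"
      by (intro onorm_le) (simp add: fun_diff_def)
  qed auto
  then show ?thesis by (simp add: power2_eq_square mult.commute)
qed

lemma fourier_integrable:
  assumes "all_moments m"
  shows "integrable lborel (\<lambda>t. exp (- 2 * of_real pi * \<i> * of_real (t \<bullet> x)) * m t)"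
proof -
  have [measurable]: "m \<in> borel_measurable borel" using assms by (simp add: all_moments_def)
  show ?thesis
    by (rule Bochner_Integration.integrable_bound[OF all_moments_integrable[OF assms]])
      (auto simp: norm_mult norm_exp)
qed

lemma norm_fourier_le: "norm (fourier m x) \<le> (LINT t|lborel. norm (m t))"
proof -
  have "norm (fourier m x) \<le>
     (LINT t|lborel. norm (exp (- 2 * of_real pi * \<i> * of_real (t \<bullet> x)) * m t))"
    unfolding fourier_def by (rule integral_norm_bound)
  then show ?thesis by (simp add: norm_mult norm_exp)
qed

lemma fourier_has_derivative:
  fixes m :: "real^'d::finite \<Rightarrow> complex"
  assumes m: "all_moments m"
  shows "(fourier m has_derivative (\<lambda>v. \<Sum>i\<in>UNIV. v $ i *\<^sub>R
     fourier (\<lambda>t. (- 2 * of_real pi * \<i>) * of_real (t $ i) * m t) x)) (at x)"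
  unfolding fourier_def[abs_def]
proof (rule has_derivative_integral_quadratic[where
      G = "\<lambda>t. (2 * pi)\<^sup>2 * ((1 + norm t) ^ 2 * norm (m t))"])
  show "integrable lborel (\<lambda>t. (2 * pi)\<^sup>2 * ((1 + norm t) ^ 2 * norm (m t)))"
    using m unfolding all_moments_def by (intro integrable_mult_right) blast
  fix v t :: "real^'d"
  let ?e = "\<lambda>x. exp (- 2 * of_real pi * \<i> * of_real (t \<bullet> x)) :: complex"
  \<comment> \<open>The change of phase caused by moving from \<open>x\<close> to
    \<open>x + v\<close>. Once the unimodular factor at \<open>x\<close> is pulled out, the
    remainder is that of \<open>exp (\<i> * \<theta>)\<close>, and \<open>\<theta>\<^sup>2\<close>
    costs a second moment of \<open>m\<close>.\<close>
  define \<theta> where "\<theta> = - (2 * pi * (t \<bullet> v))"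
  have th: "\<i> * of_real \<theta> = - 2 * of_real pi * \<i> * of_real (t \<bullet> v)"
    by (simp add: \<theta>_def)
  let ?K = "- 2 * of_real pi * \<i> :: complex"
  have sum: "(\<Sum>i\<in>UNIV. v $ i *\<^sub>R (a * (K * of_real (t $ i) * b))) = a * b * (K * of_real (t \<bullet> v))"
    for a b K :: complex
    by (simp add: inner_vec_def sum_distrib_left scaleR_conv_of_real mult_ac)
  have add: "?e (x + v) = ?e x * exp (\<i> * of_real \<theta>)"
    unfolding th exp_add[symmetric] by (simp add: inner_add_right distrib_left)
  have "?e (x + v) * m t - ?e x * m t -
      (\<Sum>i\<in>UNIV. v $ i *\<^sub>R (?e x * (?K * of_real (t $ i) * m t)))
    = ?e x * m t * (exp (\<i> * of_real \<theta>) - 1 - \<i> * of_real \<theta>)"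
    unfolding sum add th[symmetric] right_diff_distrib by (simp only: mult_ac mult_1_left)
  also have "norm \<dots> = norm (m t) * norm (exp (\<i> * of_real \<theta>) - 1 - \<i> * of_real \<theta>)"
    by (simp add: norm_mult norm_exp)
  also have "\<dots> \<le> norm (m t) * \<theta>\<^sup>2"
    by (intro mult_left_mono norm_exp_i_remainder) auto
  also have "\<dots> \<le> norm (m t) * (2 * pi * ((1 + norm t) * norm v))\<^sup>2"
  proof (intro mult_left_mono norm_ge_zero)
    have "\<bar>t \<bullet> v\<bar> \<le> (1 + norm t) * norm v"
      using Cauchy_Schwarz_ineq2[of t v] by (simp add: distrib_right add_increasing)
    then show "\<theta>\<^sup>2 \<le> (2 * pi * ((1 + norm t) * norm v))\<^sup>2"
      by (intro abs_le_square_iff[THEN iffD1]) (simp add: \<theta>_def abs_mult)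
  qed
  also have "\<dots> = (2 * pi)\<^sup>2 * ((1 + norm t) ^ 2 * norm (m t)) * (norm v)\<^sup>2"
    by (simp only: power_mult_distrib mult_ac)
  finally show "norm (?e (x + v) * m t - ?e x * m t -
      (\<Sum>i\<in>UNIV. v $ i *\<^sub>R (?e x * ((- 2 * of_real pi * \<i>) * of_real (t $ i) * m t))))
    \<le> (2 * pi)\<^sup>2 * ((1 + norm t) ^ 2 * norm (m t)) * (norm v)\<^sup>2" .
qed (intro fourier_integrable m all_moments_mult_component)+

text \<open>The polynomial symbol on the time side that corresponds to iterated differentiation on
  the frequency side.\<close>

primrec moment_mult :: "'d::finite list \<Rightarrow> (real^'d \<Rightarrow> complex) \<Rightarrow> real^'d \<Rightarrow> complex" where
  "moment_mult [] m = m"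
| "moment_mult (i # is) m = (\<lambda>t. (- 2 * of_real pi * \<i>) * of_real (t $ i) * moment_mult is m t)"

lemma all_moments_moment_mult: "all_moments m \<Longrightarrow> all_moments (moment_mult is m)"
  by (induction "is") (simp_all only: moment_mult.simps all_moments_mult_component)

lemma
  fixes m :: "real^'d::finite \<Rightarrow> complex"
  assumes m: "all_moments m"
  shows iterated_partial_fourier: "iterated_partial is (fourier m) = fourier (moment_mult is m)" (is ?A)
    and smooth_fourier: "smooth (fourier m)" (is ?B)
proof -
  define F where "F is = fourier (moment_mult is m)" for "is"
  define D where "D is x = (\<lambda>v. \<Sum>i\<in>UNIV. v $ i *\<^sub>R fourier (moment_mult (i # is) m) x)"
    for "is" and x :: "real^'d"
  have F: "F [] = fourier m" by (simp add: F_def)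
  have 1: "(F is has_derivative D is x) (at x)" for "is" x
    unfolding F_def D_def moment_mult.simps
    by (rule fourier_has_derivative[OF all_moments_moment_mult[OF m]])
  have 2: "D is x (axis i 1) = F (i # is) x" for i "is" x
    unfolding F_def D_def axis_sum_scaleR ..
  show ?A using iterated_partial_eqI[of F _ D, OF F 1 2] by (simp add: F_def)
  show ?B by (rule smoothI[of F _ D, OF F 1 2])
qed

lemma norm_iterated_partial_fourier_le:
  assumes "all_moments m"
  obtains C where "C \<ge> 0" "\<And>x. norm (iterated_partial is (fourier m) x) \<le> C"
  unfolding iterated_partial_fourier[OF assms]
  using norm_fourier_le norm_ge_zero order_trans by metis

text \<open>Substitution \<open>s = c t\<close>: the prefactor of the dilate is the Jacobian, and
  the phase is unchanged because the factors \<open>c\<close> and \<open>1 / c\<close> cancel in the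
  inner product.\<close>

lemma fourier_scale:
  fixes m :: "real^'d::finite \<Rightarrow> complex"
  assumes [measurable]: "m \<in> borel_measurable borel" and c: "c > 0"
  shows "fourier (\<lambda>t. of_real (c ^ CARD('d)) * m (c *\<^sub>R t)) x = fourier m ((1 / c) *\<^sub>R x)"
proof -
  define g where "g s = exp (- 2 * of_real pi * \<i> * of_real (s \<bullet> ((1 / c) *\<^sub>R x))) * m s" for s
  have [measurable]: "g \<in> borel_measurable borel" unfolding g_def by measurable
  have g: "(c ^ CARD('d)) *\<^sub>R g (c *\<^sub>R t) =
     exp (- 2 * of_real pi * \<i> * of_real (t \<bullet> x)) * (of_real (c ^ CARD('d)) * m (c *\<^sub>R t))" for t
  proof -
    have "(c *\<^sub>R t) \<bullet> ((1 / c) *\<^sub>R x) = t \<bullet> x" using c by simp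
    then show ?thesis unfolding g_def by (simp only: scaleR_conv_of_real mult.left_commute)
  qed
  have "fourier m ((1 / c) *\<^sub>R x) = integral\<^sup>L lborel g"
    unfolding fourier_def g_def ..
  also have "\<dots> = integral\<^sup>L (density (distr lborel borel (\<lambda>t. 0 + c *\<^sub>R t)) (\<lambda>_. \<bar>c\<bar> ^ DIM(real^'d))) g"
    using lborel_affine[of c "0::real^'d"] c by simp
  also have "\<dots> = (LINT t|lborel. (c ^ CARD('d)) *\<^sub>R g (c *\<^sub>R t))"
    using c by (subst integral_density) (auto simp: integral_distr)
  also have "\<dots> = fourier (\<lambda>t. of_real (c ^ CARD('d)) * m (c *\<^sub>R t)) x"
    unfolding fourier_def g ..
  finally show ?thesis ..
qed

section \<open>Products of multipliers with Schwartz functions\<close>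

lemma norm_sum_list_le:
  fixes f :: "'a \<Rightarrow> 'b::real_normed_vector"
  assumes "\<And>p. p \<in> set ps \<Longrightarrow> norm (f p) \<le> g p"
  shows "norm (\<Sum>p\<leftarrow>ps. f p) \<le> (\<Sum>p\<leftarrow>ps. g p)"
  using assms by (induction ps) (auto intro!: norm_triangle_le add_mono)

text \<open>The constant depends on \<open>u\<close> only through the bounds \<open>B\<close>, and scales with \<open>e\<close>.\<close>

lemma mult_schwartz_bound:
  fixes \<phi> :: "real^'d::finite \<Rightarrow> complex"
  assumes \<phi>: "\<phi> \<in> schwartz_space"
  obtains C where "\<And>u e x. smooth u \<Longrightarrow> e \<ge> 0 \<Longrightarrow>
     (\<And>is x. norm (iterated_partial is u x) \<le> B is * (1 + norm x) * e) \<Longrightarrow>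
     (1 + norm x) ^ k * norm (iterated_partial is (\<lambda>x. u x * \<phi> x) x) \<le> C * e"
proof -
  \<comment> \<open>One power more than the claim asks for, to absorb the factor
    \<open>1 + norm x\<close> allowed in the bounds on \<open>u\<close>.\<close>
  have "\<exists>D\<ge>0. \<forall>x. (1 + norm x) ^ Suc k * norm (iterated_partial b \<phi> x) \<le> D" for b
    by (rule schwartz_decay[OF \<phi>]) blast
  then obtain D where D: "\<And>b x. (1 + norm x) ^ Suc k * norm (iterated_partial b \<phi> x) \<le> D b"
    by metis
  define C where "C = (\<Sum>p\<leftarrow>leibniz_splits is. B (fst p) * D (snd p))"
  show thesis
  proof (rule that)
    fix u :: "real^'d \<Rightarrow> complex" and e :: real and x :: "real^'d"
    assume u: "smooth u" and e: "e \<ge> 0"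
      and B: "\<And>is x. norm (iterated_partial is u x) \<le> B is * (1 + norm x) * e"
    have "(1 + norm x) ^ k * norm (iterated_partial is (\<lambda>x. u x * \<phi> x) x) =
      norm (\<Sum>p\<leftarrow>leibniz_splits is. (1 + norm x) ^ k *\<^sub>R
        (iterated_partial (fst p) u x * iterated_partial (snd p) \<phi> x))"
      unfolding iterated_partial_mult[OF u schwartz_smooth[OF \<phi>]]
      by (simp add: scaleR_conv_of_real sum_list_const_mult norm_mult norm_power flip: of_real_power)
    also have "\<dots> \<le> (\<Sum>p\<leftarrow>leibniz_splits is. B (fst p) * D (snd p) * e)"
    proof (rule norm_sum_list_le)
      fix p :: "'d list \<times> 'd list"
      have "0 \<le> B (fst p) * (1 + norm x) * e" using B norm_ge_zero order_trans by blast
      \<comment> \<open>\<open>B\<close> carries no sign assumption; the bound at the origin, where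
        the weight is 1, forces this product to be nonnegative.\<close>
      moreover have "B (fst p) * e \<ge> 0"
      proof -
        have "0 \<le> B (fst p) * (1 + norm (0::real^'d)) * e" using B norm_ge_zero order_trans by blast
        then show ?thesis by simp
      qed
      ultimately have "norm (iterated_partial (fst p) u x) *
            ((1 + norm x) ^ k * norm (iterated_partial (snd p) \<phi> x))
         \<le> B (fst p) * (1 + norm x) * e * ((1 + norm x) ^ k * norm (iterated_partial (snd p) \<phi> x))"
        by (intro mult_right_mono B) auto
      also have "\<dots> = B (fst p) * e * ((1 + norm x) ^ Suc k * norm (iterated_partial (snd p) \<phi> x))"
        by (simp add: mult_ac)
      also have "\<dots> \<le> B (fst p) * e * D (snd p)"
        by (intro mult_left_mono D) fact
      finally show "norm ((1 + norm x) ^ k *\<^sub>R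
          (iterated_partial (fst p) u x * iterated_partial (snd p) \<phi> x)) \<le> B (fst p) * D (snd p) * e"
        by (simp add: norm_mult mult_ac)
    qed
    also have "\<dots> = C * e" by (simp add: C_def sum_list_mult_const)
    finally show "(1 + norm x) ^ k * norm (iterated_partial is (\<lambda>x. u x * \<phi> x) x) \<le> C * e" .
  qed
qed

text \<open>Every derivative of \<open>fourier m\<close> is bounded by an L1 norm of a moment of
  \<open>m\<close>, so the product inherits its decay from \<phi>. This is the case
  \<open>e = 1\<close> of \<open>mult_schwartz_bound\<close>.\<close>

lemma schwartz_fourier_mult:
  assumes m: "m \<in> schwartz_space" and \<phi>: "\<phi> \<in> schwartz_space"
  shows "(\<lambda>x. fourier m x * \<phi> x) \<in> schwartz_space"
proof (rule schwartzI)
  note mm = schwartz_all_moments[OF m]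
  show "smooth (\<lambda>x. fourier m x * \<phi> x)"
    by (intro smooth_mult smooth_fourier mm schwartz_smooth \<phi>)
  fix k "is"
  have "\<exists>C\<ge>0. \<forall>x. norm (iterated_partial is (fourier m) x) \<le> C" for "is"
    by (rule norm_iterated_partial_fourier_le[OF mm]) blast
  then obtain B where B: "\<And>is. B is \<ge> 0" "\<And>is x. norm (iterated_partial is (fourier m) x) \<le> B is"
    by metis
  have B': "norm (iterated_partial is (fourier m) x) \<le> B is * (1 + norm x) * 1" for "is" x
    by (rule order_trans[OF B(2)]) (simp add: B(1) distrib_left)
  show "\<exists>C. \<forall>x. (1 + norm x) ^ k * norm (iterated_partial is (\<lambda>x. fourier m x * \<phi> x) x) \<le> C"
  proof (rule mult_schwartz_bound[OF \<phi>, of B k "is"])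
    fix C
    assume "\<And>u e x. smooth u \<Longrightarrow> e \<ge> 0 \<Longrightarrow>
       (\<And>is x. norm (iterated_partial is u x) \<le> B is * (1 + norm x) * e) \<Longrightarrow>
       (1 + norm x) ^ k * norm (iterated_partial is (\<lambda>x. u x * \<phi> x) x) \<le> C * e"
    from this[OF smooth_fourier[OF mm] zero_le_one B'] show ?thesis by blast
  qed
qed

lemma schwartz_dilate:
  assumes "m \<in> schwartz_space"
  shows "(\<lambda>t. c * m (real (Suc n) *\<^sub>R t)) \<in> schwartz_space"
  using schwartz_linear[OF schwartz_scale[OF assms] schwartz_zero, of "real (Suc n)" c 0] by simp

lemma schwartz_null_fourier_dilates:
  fixes m :: "real^'d::finite \<Rightarrow> complex"
  assumes m: "m \<in> schwartz_space" and one: "(LINT t|lborel. m t) = 1" and \<phi>: "\<phi> \<in> schwartz_space"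
  shows "schwartz_null (\<lambda>n x. (fourier m ((1 / real (Suc n)) *\<^sub>R x) - 1) * \<phi> x)"
proof -
  note mm = schwartz_all_moments[OF m]
  define c where "c n = 1 / real (Suc n)" for n
  define u where "u n = (\<lambda>x. fourier m (c n *\<^sub>R x) - 1)" for n
  have c: "0 < c n" "c n \<le> 1" for n by (auto simp: c_def)
  have uL: "u n = (\<lambda>x. 1 * fourier m (c n *\<^sub>R x) + (- 1) * 1)" for n by (simp add: u_def)
  have sm: "smooth (\<lambda>x. fourier m (c n *\<^sub>R x))" for n by (intro smooth_scale smooth_fourier mm)
  have su: "smooth (u n)" for n
    unfolding uL by (rule smooth_linear[OF sm smooth_const])
  have iter: "iterated_partial is (u n) x =
     c n ^ length is *\<^sub>R iterated_partial is (fourier m) (c n *\<^sub>R x) - (if is = [] then 1 else 0)" for "is" n x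
    unfolding uL iterated_partial_linear[OF sm smooth_const]
      iterated_partial_scale[OF smooth_fourier[OF mm]] iterated_partial_const by simp
  have "\<exists>C\<ge>0. \<forall>x. norm (iterated_partial is (fourier m) x) \<le> C" for "is"
    by (rule norm_iterated_partial_fourier_le[OF mm]) blast
  then obtain B where B: "\<And>is. B is \<ge> 0" "\<And>is x. norm (iterated_partial is (fourier m) x) \<le> B is"
    by metis
  define L where "L = (\<Sum>i\<in>UNIV. B [i])"
  have L: "norm (iterated_partial [i] (fourier m) x) \<le> L" for i x
  proof -
    have "B [i] \<le> L" unfolding L_def by (rule member_le_sum) (auto simp: B)
    then show ?thesis using B(2) order_trans by blast
  qed
  have L0: "0 \<le> L" unfolding L_def by (intro sum_nonneg B)
  have zero: "fourier m 0 = 1" using one by (simp add: fourier_def)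
  \<comment> \<open>The undifferentiated function is compared with its value at the origin by the
    Lipschitz bound, giving \<open>norm x * c n\<close>. For proper derivatives the constant 1
    disappears and the chain rule supplies powers of \<open>c n\<close>.\<close>
  define B' where "B' is = (if is = [] then real CARD('d) * L else B is)" for "is"
  have bound: "norm (iterated_partial is (u n) x) \<le> B' is * (1 + norm x) * c n" for "is" n x
  proof (cases "is = []")
    case True
    have "norm (fourier m (c n *\<^sub>R x) - fourier m 0) \<le> real CARD('d) * L * norm (c n *\<^sub>R x - 0)"
      by (rule smooth_lipschitz[OF smooth_fourier[OF mm] L])
    also have "\<dots> = real CARD('d) * L * norm x * c n" using c[of n] by simp
    also have "\<dots> \<le> real CARD('d) * L * (1 + norm x) * c n"
      using c[of n] L0 by (intro mult_right_mono mult_left_mono) auto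
    finally show ?thesis using True zero by (simp add: B'_def u_def)
  next
    case False
    \<comment> \<open>A nonempty list contributes at least one factor \<open>c n\<close>; the others
      are at most 1.\<close>
    have "c n ^ length is \<le> c n ^ 1"
      using c[of n] False by (intro power_decreasing) (auto simp: Suc_le_eq)
    then have "c n ^ length is * norm (iterated_partial is (fourier m) (c n *\<^sub>R x)) \<le> c n * B is"
      using c[of n] by (intro mult_mono B) auto
    also have "\<dots> \<le> B is * (1 + norm x) * c n"
      using c[of n] B(1)[of "is"] by (simp add: algebra_simps)
    finally show ?thesis using False c[of n] by (simp add: iter B'_def)
  qed
  have "schwartz_null (\<lambda>n x. u n x * \<phi> x)"
  proof (rule schwartz_nullI)
    fix n
    \<comment> \<open>Expanding the product leaves \<phi> subtracted from a multiplier applied to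
      \<phi>, and that multiplier is the transform of a Schwartz function, the L1-dilate of
      \<open>m\<close>.\<close>
    have "(\<lambda>x. 1 * (fourier (\<lambda>t. of_real (real (Suc n) ^ CARD('d)) * m (real (Suc n) *\<^sub>R t)) x * \<phi> x)
        + (- 1) * \<phi> x) \<in> schwartz_space"
      by (intro schwartz_linear schwartz_fourier_mult \<phi> schwartz_dilate m)
    moreover have "fourier (\<lambda>t. of_real (real (Suc n) ^ CARD('d)) * m (real (Suc n) *\<^sub>R t)) =
      (\<lambda>x. fourier m (c n *\<^sub>R x))"
      unfolding c_def by (intro ext fourier_scale schwartz_measurable m) simp
    ultimately show "(\<lambda>x. u n x * \<phi> x) \<in> schwartz_space"
      by (simp add: u_def left_diff_distrib)
  next
    fix k "is"
    show "\<exists>C. \<forall>n x. (1 + norm x) ^ k * norm (iterated_partial is (\<lambda>x. u n x * \<phi> x) x) \<le> C / real (Suc n)"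
    proof (rule mult_schwartz_bound[OF \<phi>, of B' k "is"])
      fix C
      assume "\<And>u e x. smooth u \<Longrightarrow> e \<ge> 0 \<Longrightarrow>
         (\<And>is x. norm (iterated_partial is u x) \<le> B' is * (1 + norm x) * e) \<Longrightarrow>
         (1 + norm x) ^ k * norm (iterated_partial is (\<lambda>x. u x * \<phi> x) x) \<le> C * e"
      from this[OF su less_imp_le[OF c(1)] bound] show ?thesis
        by (intro exI[of _ C]) (simp add: c_def)
    qed
  qed
  then show ?thesis by (simp add: u_def c_def)
qed

section \<open>The Gaussian\<close>

text \<open>Partial derivatives of polynomials are again polynomials; this keeps the derivatives of
  the Gaussian in the form polynomial times Gaussian.\<close>

lemma real_polynomial_has_derivative:
  fixes p :: "real^'d::finite \<Rightarrow> real"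
  assumes "real_polynomial_function p"
  shows "\<exists>p'. (\<forall>i. real_polynomial_function (p' i)) \<and>
     (\<forall>x. (p has_derivative (\<lambda>v. \<Sum>i\<in>UNIV. v $ i * p' i x)) (at x))"
  using assms
proof induction
  case (linear f)
  then have l: "linear f" by (rule bounded_linear.linear)
  have "f v = (\<Sum>i\<in>UNIV. v $ i * f (axis i 1))" for v
  proof -
    have "f v = f (\<Sum>i\<in>UNIV. v $ i *\<^sub>R axis i 1)"
      by (simp only: axis_expansion)
    then show ?thesis by (simp add: linear_sum[OF l] linear_scale[OF l])
  qed
  then have "(\<lambda>v. \<Sum>i\<in>UNIV. v $ i * f (axis i 1)) = f"
    by (intro ext) (rule sym)
  then show ?case
    using bounded_linear_imp_has_derivative[OF linear]
    by (intro exI[of _ "\<lambda>i x. f (axis i 1)"]) (simp add: real_polynomial_function.intros(2))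
next
  case (const c)
  show ?case
    by (intro exI[of _ "\<lambda>i x. 0"]) (simp add: real_polynomial_function.intros(2))
next
  case (add f g)
  obtain f' where f: "\<And>i. real_polynomial_function (f' i)"
      "\<And>x. (f has_derivative (\<lambda>v. \<Sum>i\<in>UNIV. v $ i * f' i x)) (at x)"
    using add.IH(1) by blast
  obtain g' where g: "\<And>i. real_polynomial_function (g' i)"
      "\<And>x. (g has_derivative (\<lambda>v. \<Sum>i\<in>UNIV. v $ i * g' i x)) (at x)"
    using add.IH(2) by blast
  have "((\<lambda>x. f x + g x) has_derivative (\<lambda>v. \<Sum>i\<in>UNIV. v $ i * (f' i x + g' i x))) (at x)" for x
    using has_derivative_add[OF f(2) g(2), of x] by (simp add: sum.distrib distrib_left)
  then show ?case using f(1) g(1)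
    by (intro exI[of _ "\<lambda>i x. f' i x + g' i x"]) (simp add: real_polynomial_function.intros(3))
next
  case (mult f g)
  obtain f' where f: "\<And>i. real_polynomial_function (f' i)"
      "\<And>x. (f has_derivative (\<lambda>v. \<Sum>i\<in>UNIV. v $ i * f' i x)) (at x)"
    using mult.IH(1) by blast
  obtain g' where g: "\<And>i. real_polynomial_function (g' i)"
      "\<And>x. (g has_derivative (\<lambda>v. \<Sum>i\<in>UNIV. v $ i * g' i x)) (at x)"
    using mult.IH(2) by blast
  have "((\<lambda>x. f x * g x) has_derivative (\<lambda>v. \<Sum>i\<in>UNIV. v $ i * (f x * g' i x + f' i x * g x))) (at x)" for x
    using has_derivative_mult[OF f(2) g(2), of x]
    by (simp add: sum.distrib distrib_left sum_distrib_left sum_distrib_right mult_ac)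
  then show ?case using f(1) g(1) mult.hyps
    by (intro exI[of _ "\<lambda>i x. f x * g' i x + f' i x * g x"])
      (simp add: real_polynomial_function.intros(3) real_polynomial_function.intros(4))
qed

lemma real_polynomial_bound:
  fixes p :: "'a::real_normed_vector \<Rightarrow> real"
  assumes "real_polynomial_function p"
  shows "\<exists>C k. C \<ge> 0 \<and> (\<forall>x. \<bar>p x\<bar> \<le> C * (1 + norm x) ^ k)"
  using assms
proof induction
  case (linear f)
  obtain K where K: "K > 0" "\<And>x. norm (f x) \<le> norm x * K"
    using bounded_linear.pos_bounded[OF linear] by blast
  have "\<bar>f x\<bar> \<le> K * (1 + norm x) ^ 1" for x
    using K(2)[of x] K(1) by (simp add: distrib_left mult.commute)
  then show ?case using K(1) less_imp_le by blast
next
  case (const c)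
  have "\<bar>c\<bar> \<le> \<bar>c\<bar> * (1 + norm x) ^ 0" for x :: 'a by simp
  then show ?case using abs_ge_zero by blast
next
  case (add f g)
  then obtain C k D l where f: "C \<ge> 0" "\<And>x. \<bar>f x\<bar> \<le> C * (1 + norm x) ^ k"
    and g: "D \<ge> 0" "\<And>x. \<bar>g x\<bar> \<le> D * (1 + norm x) ^ l" by metis
  have "\<bar>f x + g x\<bar> \<le> (C + D) * (1 + norm x) ^ (k + l)" for x
  proof -
    have "C * (1 + norm x) ^ k \<le> C * (1 + norm x) ^ (k + l)"
      using f(1) by (intro mult_left_mono power_increasing) auto
    moreover have "D * (1 + norm x) ^ l \<le> D * (1 + norm x) ^ (k + l)"
      using g(1) by (intro mult_left_mono power_increasing) auto
    ultimately show ?thesis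
      using f(2)[of x] g(2)[of x] abs_triangle_ineq[of "f x" "g x"]
      unfolding distrib_right by linarith
  qed
  then show ?case using f(1) g(1) add_nonneg_nonneg by blast
next
  case (mult f g)
  then obtain C k D l where f: "C \<ge> 0" "\<And>x. \<bar>f x\<bar> \<le> C * (1 + norm x) ^ k"
    and g: "D \<ge> 0" "\<And>x. \<bar>g x\<bar> \<le> D * (1 + norm x) ^ l" by metis
  have "\<bar>f x * g x\<bar> \<le> (C * D) * (1 + norm x) ^ (k + l)" for x
  proof -
    have "\<bar>f x * g x\<bar> \<le> (C * (1 + norm x) ^ k) * (D * (1 + norm x) ^ l)"
      unfolding abs_mult using f(1) by (intro mult_mono f(2) g(2)) auto
    then show ?thesis by (simp add: power_add mult_ac)
  qed
  then show ?case using f(1) g(1) mult_nonneg_nonneg by blast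
qed

text \<open>One term of the exponential series bounds the \<open>k\<close>-th power of the weight by
  \<open>fact k * exp (1 + norm x)\<close>. The remaining exponent
  \<open>1 + norm x - (norm x)\<^sup>2\<close> is at most 2 since
  \<open>(norm x - 1)\<^sup>2 \<ge> 0\<close>.\<close>

lemma weight_gaussian_bound:
  "(1 + norm x) ^ k * exp (- (x \<bullet> x)) \<le> fact k * exp 2" for x :: "'a::real_inner"
proof -
  have "(1 + norm x) ^ k / fact k \<le> exp (1 + norm x)"
  proof -
    have "(\<lambda>n. (1 + norm x) ^ n / fact n) sums exp (1 + norm x)"
      using exp_converges[of "1 + norm x"] by (simp add: divide_inverse mult.commute)
    from sum_le_suminf[OF sums_summable[OF this], of "{k}"] sums_unique[OF this]
    show ?thesis by simp
  qed
  then have "(1 + norm x) ^ k \<le> fact k * exp (1 + norm x)"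
    by (simp add: divide_le_eq mult.commute)
  then have "(1 + norm x) ^ k * exp (- (x \<bullet> x)) \<le> fact k * exp (1 + norm x) * exp (- (x \<bullet> x))"
    by (rule mult_right_mono) simp
  also have "\<dots> = fact k * exp (1 + norm x - (norm x)\<^sup>2)"
    by (simp add: exp_add[symmetric] exp_diff power2_norm_eq_inner exp_minus field_simps)
  also have "\<dots> \<le> fact k * exp 2"
  proof -
    have "0 \<le> (norm x - 1)\<^sup>2" by simp
    then have "2 * norm x \<le> 1 + (norm x)\<^sup>2" by (simp add: power2_diff)
    moreover have "0 \<le> norm x" "0 \<le> (norm x)\<^sup>2" by auto
    ultimately have "1 + norm x - (norm x)\<^sup>2 \<le> 2" by linarith
    then show ?thesis by simp
  qed
  finally show ?thesis .
qed

definition gaussian :: "real^'d::finite \<Rightarrow> complex" where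
  "gaussian x = of_real (exp (- (x \<bullet> x)))"

text \<open>Differentiating in direction \<open>i\<close> replaces the polynomial \<open>p\<close>
  by its \<open>i\<close>-th partial minus \<open>2 * x $ i * p\<close>, the recurrence of the
  Hermite polynomials up to sign.\<close>

lemma gaussian_iterated_partial:
  fixes "is" :: "'d::finite list"
  shows "\<exists>p. real_polynomial_function p \<and>
     iterated_partial is gaussian = (\<lambda>x. of_real (p x * exp (- (x \<bullet> x))))"
    and "iterated_partial is gaussian differentiable (at x)"
proof -
  have step: "\<exists>D. ((\<lambda>x. of_real (p x * exp (- (x \<bullet> x))) :: complex) has_derivative D) (at x) \<and>
      (\<forall>i. D (axis i 1) = of_real ((p' i x - 2 * x $ i * p x) * exp (- (x \<bullet> x))))"
    if "(p has_derivative (\<lambda>v. \<Sum>i\<in>UNIV. v $ i * p' i x)) (at x)"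
    for p p' and x :: "real^'d"
  proof -
    have a: "(\<Sum>j\<in>UNIV. p' j x * axis i 1 $ j) = p' i x" for i :: 'd
      using axis_sum_scaleR[of i "\<lambda>j. p' j x"] by (simp add: mult.commute)
    have b: "x \<bullet> axis i 1 = x $ i" "axis i 1 \<bullet> x = x $ i" for i
      by (simp_all add: inner_axis inner_commute)
    show ?thesis
      by (rule exI, rule conjI,
          rule has_derivative_of_real[OF has_derivative_mult[OF that
            has_derivative_exp[OF has_derivative_minus[OF
              has_derivative_inner[OF has_derivative_ident has_derivative_ident]]]]])
        (simp add: a b algebra_simps del: of_real_mult of_real_add of_real_diff of_real_sum of_real_minus)
  qed
  show ex: "\<exists>p. real_polynomial_function p \<and>
     iterated_partial is gaussian = (\<lambda>x. of_real (p x * exp (- (x \<bullet> x))))" for "is" :: "'d list"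
  proof (induction "is")
    case Nil
    then show ?case by (intro exI[of _ "\<lambda>x. 1"]) (simp add: real_polynomial_function.intros(2) gaussian_def[abs_def])
  next
    case (Cons i "is")
    then obtain p where p: "real_polynomial_function p"
      "iterated_partial is gaussian = (\<lambda>x. of_real (p x * exp (- (x \<bullet> x))))" by blast
    obtain p' where p': "\<And>i. real_polynomial_function (p' i)"
      "\<And>x. (p has_derivative (\<lambda>v. \<Sum>i\<in>UNIV. v $ i * p' i x)) (at x)"
      using real_polynomial_has_derivative[OF p(1)] by blast
    have "iterated_partial (i # is) gaussian x =
        of_real ((p' i x - 2 * x $ i * p x) * exp (- (x \<bullet> x)))" for x
    proof -
      obtain D where "(iterated_partial is gaussian has_derivative D) (at x)"
        "D (axis i 1) = of_real ((p' i x - 2 * x $ i * p x) * exp (- (x \<bullet> x)))"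
        using step[of p p' x, OF p'(2)] unfolding p(2) by blast
      then show ?thesis using partial_derivative_eq by fastforce
    qed
    moreover have "real_polynomial_function (\<lambda>x. p' i x + (- 2 * x $ i) * p x)"
      by (intro real_polynomial_function.intros p p' bounded_linear_mult_const
          bounded_linear_const_mult bounded_linear_vec_nth)
    ultimately show ?case
      by (intro exI[of _ "\<lambda>x. p' i x + (- 2 * x $ i) * p x"]) (simp add: fun_eq_iff)
  qed
  obtain p where p: "real_polynomial_function p"
    "iterated_partial is gaussian = (\<lambda>x. of_real (p x * exp (- (x \<bullet> x))))" using ex by blast
  obtain p' where p': "\<And>x. (p has_derivative (\<lambda>v. \<Sum>i\<in>UNIV. v $ i * p' i x)) (at x)"
    using real_polynomial_has_derivative[OF p(1)] by blast
  from step[of p p' x, OF p'] show "iterated_partial is gaussian differentiable (at x)"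
    unfolding p(2) differentiable_def by blast
qed

lemma schwartz_gaussian: "gaussian \<in> schwartz_space"
proof (rule schwartzI)
  show "smooth gaussian" unfolding smooth_def by (intro allI gaussian_iterated_partial(2))
  fix k and "is" :: "'a list"
  obtain p where p: "real_polynomial_function p"
    "iterated_partial is gaussian = (\<lambda>x. of_real (p x * exp (- (x \<bullet> x))))"
    using gaussian_iterated_partial(1) by blast
  obtain C l where C: "C \<ge> 0" "\<And>x. \<bar>p x\<bar> \<le> C * (1 + norm x) ^ l"
    using real_polynomial_bound[OF p(1)] by blast
  have "(1 + norm x) ^ k * norm (iterated_partial is gaussian x) \<le> C * (fact (k + l) * exp 2)" for x
  proof -
    have "(1 + norm x) ^ k * norm (iterated_partial is gaussian x) =
        (1 + norm x) ^ k * (\<bar>p x\<bar> * exp (- (x \<bullet> x)))"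
      unfolding p(2) norm_of_real abs_mult by simp
    also have "\<dots> \<le> (1 + norm x) ^ k * (C * (1 + norm x) ^ l * exp (- (x \<bullet> x)))"
      by (intro mult_left_mono mult_right_mono C) auto
    also have "\<dots> = C * ((1 + norm x) ^ (k + l) * exp (- (x \<bullet> x)))"
      by (simp add: power_add mult_ac)
    also have "\<dots> \<le> C * (fact (k + l) * exp 2)"
      by (intro mult_left_mono weight_gaussian_bound C)
    finally show ?thesis .
  qed
  then show "\<exists>C. \<forall>x. (1 + norm x) ^ k * norm (iterated_partial is gaussian x) \<le> C" by blast
qed

text \<open>A nonnegative integrand with integral 0 vanishes almost everywhere; as this one is
  positive everywhere, the whole space would be a null set.\<close>

lemma integral_gaussian_nonzero: "(LINT x|lborel. gaussian (x::real^'d::finite)) \<noteq> 0"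
proof -
  let ?g = "\<lambda>x::real^'d. exp (- (x \<bullet> x))"
  have int: "integrable lborel ?g"
    using integrable_norm[OF schwartz_integrable[OF schwartz_gaussian]] by (simp add: gaussian_def)
  have "integral\<^sup>L lborel ?g \<noteq> 0"
  proof
    assume "integral\<^sup>L lborel ?g = 0"
    then have "AE x in lborel. ?g x = 0"
      using integral_nonneg_eq_0_iff_AE[OF int] by simp
    then have "emeasure lborel {x \<in> space (lborel :: (real^'d) measure). True} = 0"
      by (intro emeasure_eq_0_AE) simp
    then show False by (simp add: emeasure_lborel_UNIV)
  qed
  then show ?thesis unfolding gaussian_def by simp
qed

lemma exists_schwartz_integral_one:
  "\<exists>m\<in>schwartz_space. (LINT t|lborel. m (t::real^'d::finite)) = (1::complex)"
proof -
  define c where "c = (LINT t|lborel. gaussian (t::real^'d))"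
  \<comment> \<open>The zero summand only fits the function to the two-term shape of
    \<open>schwartz_linear\<close>.\<close>
  have "(\<lambda>t. 1 / c * gaussian t + 0 * gaussian t) \<in> (schwartz_space :: (real^'d \<Rightarrow> complex) set)"
    by (intro schwartz_linear schwartz_gaussian)
  moreover have "(LINT t|lborel. 1 / c * gaussian (t::real^'d) + 0 * gaussian t) = 1"
    using integral_gaussian_nonzero[where 'd = 'd] by (simp add: c_def[symmetric])
  ultimately show ?thesis by blast
qed

section \<open>Multipliers determine the distribution\<close>

lemma fourier_mult_dist_eq_iff:
  fixes T :: "'d::finite functional"
  assumes T: "null_continuous T"
  shows "(\<forall>m \<in> schwartz_space. dist_mult (fourier m) T =\<^sub>S dist_of_fun (fourier m))
     \<longleftrightarrow> T =\<^sub>S dist_of_fun (\<lambda>_. 1)"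
proof
  assume *: "T =\<^sub>S dist_of_fun (\<lambda>_. 1)"
  show "\<forall>m \<in> schwartz_space. dist_mult (fourier m) T =\<^sub>S dist_of_fun (fourier m)"
    unfolding dist_eq_def
  proof (intro ballI)
    fix m \<phi> :: "real^'d \<Rightarrow> complex"
    assume "m \<in> schwartz_space" "\<phi> \<in> schwartz_space"
    from *[unfolded dist_eq_def, rule_format, OF schwartz_fourier_mult[OF this]]
    show "dist_mult (fourier m) T \<phi> = dist_of_fun (fourier m) \<phi>"
      by (simp add: dist_mult_def dist_of_fun_def)
  qed
next
  assume *: "\<forall>m \<in> schwartz_space. dist_mult (fourier m) T =\<^sub>S dist_of_fun (fourier m)"
  let ?I = "dist_of_fun (\<lambda>_. 1) :: 'd functional"
  have eq: "T (\<lambda>x. fourier m x * \<phi> x) = ?I (\<lambda>x. fourier m x * \<phi> x)"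
    if "m \<in> schwartz_space" "\<phi> \<in> schwartz_space" for m \<phi>
    using *[unfolded dist_eq_def, rule_format, OF that]
    by (simp add: dist_mult_def dist_of_fun_def)
  obtain m :: "real^'d \<Rightarrow> complex" where m: "m \<in> schwartz_space" "(LINT t|lborel. m t) = 1"
    using exists_schwartz_integral_one by blast
  show "T =\<^sub>S ?I"
    unfolding dist_eq_def
  proof
    fix \<phi> :: "real^'d \<Rightarrow> complex" assume \<phi>: "\<phi> \<in> schwartz_space"
    define \<psi> where "\<psi> n x = (fourier m ((1 / real (Suc n)) *\<^sub>R x) - 1) * \<phi> x" for n x
    have null: "schwartz_null \<psi>"
      unfolding \<psi>_def[abs_def] by (rule schwartz_null_fourier_dilates[OF m \<phi>])
    \<comment> \<open>By hypothesis \<open>T\<close> and \<open>?I\<close> agree on the multiplier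
      part of \<open>\<psi> n\<close>, so their difference there does not depend on
      \<open>n\<close>. A constant sequence that tends to 0 is 0.\<close>
    have diff: "T (\<psi> n) - ?I (\<psi> n) = ?I \<phi> - T \<phi>" for n
    proof -
      define M where "M t = of_real (real (Suc n) ^ CARD('d)) * m (real (Suc n) *\<^sub>R t)" for t
      have M: "M \<in> schwartz_space"
        unfolding M_def[abs_def] by (rule schwartz_dilate[OF m(1)])
      have "\<psi> n = (\<lambda>x. 1 * (fourier M x * \<phi> x) + (- 1) * \<phi> x)"
      proof
        fix x
        have "fourier M x = fourier m ((1 / real (Suc n)) *\<^sub>R x)"
          unfolding M_def[abs_def] by (intro fourier_scale schwartz_measurable m) simp
        then show "\<psi> n x = 1 * (fourier M x * \<phi> x) + (- 1) * \<phi> x"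
          unfolding \<psi>_def by (simp add: left_diff_distrib)
      qed
      then show ?thesis
        using null_continuous_linear[OF T schwartz_fourier_mult[OF M \<phi>] \<phi>, of 1 "-1"]
          null_continuous_linear[OF null_continuous_one schwartz_fourier_mult[OF M \<phi>] \<phi>, of 1 "-1"]
          eq[OF M \<phi>] by simp
    qed
    have "(\<lambda>n. T (\<psi> n) - ?I (\<psi> n)) \<longlonglongrightarrow> 0 - 0"
      by (intro tendsto_diff null_continuous_tendsto T null_continuous_one null)
    then have "?I \<phi> - T \<phi> = 0"
      unfolding diff by (simp add: tendsto_const_iff)
    then show "T \<phi> = ?I \<phi>" by simp
  qed
qed

theorem corollary4p3:
  shows "(\<forall>g\<^sub>1 \<in> (tempered_distributions :: 'd::finite functional set). \<forall>g\<^sub>2 \<in> schwartz_space.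
            (\<forall>m \<in> schwartz_space.
               dist_mult (fourier m) (window_corr_dist_fun g\<^sub>1 g\<^sub>2) =\<^sub>S dist_of_fun (fourier m))
            \<longleftrightarrow> window_corr_dist_fun g\<^sub>1 g\<^sub>2 =\<^sub>S dist_of_fun (\<lambda>_. 1))
       \<and> (\<forall>g\<^sub>1 \<in> schwartz_space. \<forall>g\<^sub>2 \<in> (tempered_distributions :: 'd functional set).
            (\<forall>m \<in> schwartz_space.
               dist_mult (fourier m) (window_corr_fun_dist g\<^sub>1 g\<^sub>2) =\<^sub>S dist_of_fun (fourier m))
            \<longleftrightarrow> window_corr_fun_dist g\<^sub>1 g\<^sub>2 =\<^sub>S dist_of_fun (\<lambda>_. 1))"
\<comment> \<open>Both cases are instances of the multiplier criterion; what remains is null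
  continuity, obtained from conjugating \<open>g\<^sub>1\<close> in one case and reflecting
  \<open>g\<^sub>2\<close> in the other before convolving.\<close>
proof (intro conjI ballI fourier_mult_dist_eq_iff)
  fix g\<^sub>1 :: "'d functional" and g\<^sub>2 :: "real^'d \<Rightarrow> complex"
  assume "g\<^sub>1 \<in> tempered_distributions" "g\<^sub>2 \<in> schwartz_space"
  then show "null_continuous (window_corr_dist_fun g\<^sub>1 g\<^sub>2)"
    unfolding window_corr_dist_fun_def
    by (intro null_continuous_convolve_fun_dist null_continuous_dist_conj
        tempered_null_continuous schwartz_reflect)
next
  fix g\<^sub>1 :: "real^'d \<Rightarrow> complex" and g\<^sub>2 :: "'d functional"
  assume "g\<^sub>1 \<in> schwartz_space" "g\<^sub>2 \<in> tempered_distributions"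
  then show "null_continuous (window_corr_fun_dist g\<^sub>1 g\<^sub>2)"
    unfolding window_corr_fun_dist_def convolve_dist_fun_def
    by (intro null_continuous_convolve_fun_dist null_continuous_dist_reflect
        tempered_null_continuous schwartz_conj_fun)
qed

end
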